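(* Let $1\le p_0<2<q_0\le\infty$ and $p\in(p_0,q_0)$, and let $\mathcal S=\{I_n:=[0,2^{-n}]:n\in\mathbb N\}$ (with $0\in\mathbb N$), a sparse collection of dyadic intervals of $\mathbb R$. Consider, for a function $\Phi$, the inequality $$\sum_{I\in\mathcal S}|I|\,\langle|f|^{p_0}\rangle_I^{1/p_0}\,\langle|g|^{q_0'}\rangle_I^{1/q_0'}\lesssim\Phi\big([\omega]_{p_0,q_0,p}\big)\,\|f\|_{L^p_\omega}\,\|g\|_{L^{p'}_\sigma},\qquad \sigma:=\omega^{1-p'}.$$ Then, asymptotically as $r\to\infty$, the power function $\Phi(r)=r^\alpha$ is the best possible choice, where $\mathfrak p:=1+\frac{p_0}{q_0'}$ and $$\alpha=\frac1{p-p_0}\ \text{ if } p\in(p_0,\mathfrak p],\qquad \alpha=\frac{q_0-1}{q_0-p}\ \text{ if } p\in[\mathfrak p,q_0).$$ That is, there exist a constant $c>0$, $\varepsilon_0>0$ and, for $\varepsilon\in(0,\varepsilon_0)$, weights $\omega_\varepsilon\in A_{\frac p{p_0}}\cap RH_{(\frac{q_0}p)'}$ on $\mathbb R$ with $[\omega_\varepsilon]_{p_0,q_0,p}\to\infty$ as $\varepsilon\to0$, and non-zero functions $f_\varepsilon\in L^p_{\omega_\varepsilon}$, $g_\varepsilon\in L^{p'}_{\sigma_\varepsilon}$ with $\sigma_\varepsilon=\omega_\varepsilon^{1-p'}$, such that $$\sum_{I\in\mathcal S}|I|\,\langle|f_\varepsilon|^{p_0}\rangle_I^{1/p_0}\,\langle|g_\varepsilon|^{q_0'}\rangle_I^{1/q_0'}\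 \ge\ c\,[\omega_\varepsilon]_{p_0,q_0,p}^{\alpha}\,\|f_\varepsilon\|_{L^p_{\omega_\varepsilon}}\,\|g_\varepsilon\|_{L^{p'}_{\sigma_\varepsilon}}.$$
   Context: $\mathbb R$ carries its usual metric and Lebesgue measure. $|I|$ is the length of an interval $I$ and $\langle h\rangle_I:=\frac1{|I|}\int_I h\,dx$. A prime denotes the conjugate exponent. $\|f\|_{L^p_\omega}=(\int_{\mathbb R}|f|^p\omega\,dx)^{1/p}$. A weight is a measurable positive function $\omega$ (defined a.e.). For $1<q<\infty$, $[\omega]_{A_q}:=\sup_B\langle\omega\rangle_B\,\langle\omega^{1-q'}\rangle_B^{q-1}$, and for $1<s<\infty$, $[\omega]_{RH_s}:=\sup_B\langle\omega^s\rangle_B^{1/s}\,\langle\omega\rangle_B^{-1}$, suprema over all bounded intervals $B$; $A_q$ and $RH_s$ are the classes of weights for which these are finite. If $q_0=\infty$ then $(q_0/p)'=1$, $RH_1$ is no condition, $[\omega]_{RH_1}=1$, and $\frac{q_0-1}{q_0-p}$ is read as $1$. Finally $$[\omega]_{p_0,q_0,p}:=[\omega]_{A_{\frac p{p_0}}}\,[\omega]_{RH_{\left(\frac{q_0}p\right)'}}.$$ *)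

theory Defs
  imports "HOL-Analysis.Analysis"
begin

text \<open>
  Averages, weight constants, norms and the sparse form are integrals of nonnegative functions and
  take values in \<^typ>\<open>ennreal\<close>, so that finiteness is always a genuine condition.
  Exponents that may be infinite are of type \<^typ>\<open>ereal\<close>.
\<close>

text \<open>Real powers of extended nonnegative numbers; only used with an exponent \<open>a > 0\<close>.\<close>

definition epowr :: "ennreal \<Rightarrow> real \<Rightarrow> ennreal" (infixr "epowr" 80) where
  "x epowr a = (if x = \<infinity> then \<infinity> else ennreal (enn2real x powr a))"

text \<open>Intended for \<open>1 < q \<le> \<infinity>\<close>, where the conjugate exponent is a real number.\<close>

definition conj_exponent :: "ereal \<Rightarrow> real" where
  "conj_exponent q = (if q = \<infinity> then 1 else real_of_ereal q / (real_of_ereal q - 1))"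

definition bounded_intervals :: "real set set" where
  "bounded_intervals = {B. is_interval B \<and> bounded B \<and> 0 < measure lebesgue B}"

definition average :: "real set \<Rightarrow> (real \<Rightarrow> real) \<Rightarrow> ennreal" where
  "average B h = (\<integral>\<^sup>+x\<in>B. ennreal (h x) \<partial>lebesgue) / emeasure lebesgue B"

definition weight :: "(real \<Rightarrow> real) \<Rightarrow> bool" where
  "weight \<omega> \<longleftrightarrow> \<omega> \<in> borel_measurable lebesgue \<and> (AE x in lebesgue. 0 < \<omega> x)"

definition A_const :: "real \<Rightarrow> (real \<Rightarrow> real) \<Rightarrow> ennreal" where
  "A_const q \<omega> =
    (SUP B\<in>bounded_intervals.
      average B \<omega> * average B (\<lambda>x. \<omega> x powr (1 - conj_exponent q)) epowr (q - 1))"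

definition A_class :: "real \<Rightarrow> (real \<Rightarrow> real) set" where
  "A_class q = {\<omega>. weight \<omega> \<and> A_const q \<omega> < \<infinity>}"

text \<open>
  The quotient \<open>\<infinity> / \<infinity>\<close>, which is \<open>0\<close> here, only occurs for weights that are not locally
  integrable. Such weights belong to no class \<open>A\<^sub>q\<close>, and the reverse Hoelder constant is
  only used for weights in some \<open>A\<^sub>q\<close>.
\<close>

definition RH_const :: "real \<Rightarrow> (real \<Rightarrow> real) \<Rightarrow> ennreal" where
  "RH_const s \<omega> =
    (if s = 1 then 1
     else (SUP B\<in>bounded_intervals.
       average B (\<lambda>x. \<omega> x powr s) epowr (1 / s) / average B \<omega>))"

definition RH_class :: "real \<Rightarrow> (real \<Rightarrow> real) set" where
  "RH_class s = {\<omega>. weight \<omega> \<and> RH_const s \<omega> < \<infinity>}"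

definition weight_const :: "real \<Rightarrow> ereal \<Rightarrow> real \<Rightarrow> (real \<Rightarrow> real) \<Rightarrow> ennreal" where
  "weight_const p0 q0 p \<omega> =
    A_const (p / p0) \<omega> * RH_const (conj_exponent (q0 / ereal p)) \<omega>"

definition dual_weight :: "real \<Rightarrow> (real \<Rightarrow> real) \<Rightarrow> real \<Rightarrow> real" where
  "dual_weight p \<omega> = (\<lambda>x. \<omega> x powr (1 - conj_exponent p))"

definition wnorm :: "real \<Rightarrow> (real \<Rightarrow> real) \<Rightarrow> (real \<Rightarrow> real) \<Rightarrow> ennreal" where
  "wnorm p \<omega> f = (\<integral>\<^sup>+x. ennreal (\<bar>f x\<bar> powr p * \<omega> x) \<partial>lebesgue) epowr (1 / p)"

definition wLp :: "real \<Rightarrow> (real \<Rightarrow> real) \<Rightarrow> (real \<Rightarrow> real) set" where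
  "wLp p \<omega> = {f \<in> borel_measurable lebesgue. wnorm p \<omega> f < \<infinity>}"

definition dyadic_chain :: "real set set" where
  "dyadic_chain = range (\<lambda>n::nat. {0..(1/2) ^ n})"

definition sparse_form ::
  "real set set \<Rightarrow> real \<Rightarrow> ereal \<Rightarrow> (real \<Rightarrow> real) \<Rightarrow> (real \<Rightarrow> real) \<Rightarrow> ennreal" where
  "sparse_form S p0 q0 f g =
    (\<Sum>\<^sub>\<infinity>I\<in>S. emeasure lebesgue I
      * average I (\<lambda>x. \<bar>f x\<bar> powr p0) epowr (1 / p0)
      * average I (\<lambda>x. \<bar>g x\<bar> powr conj_exponent q0) epowr (1 / conj_exponent q0))"

definition critical_exponent :: "real \<Rightarrow> ereal \<Rightarrow> real" where
  "critical_exponent p0 q0 = 1 + p0 / conj_exponent q0"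

definition sharp_exponent :: "real \<Rightarrow> ereal \<Rightarrow> real \<Rightarrow> real" where
  "sharp_exponent p0 q0 p =
    (if p \<le> critical_exponent p0 q0 then 1 / (p - p0)
     else if q0 = \<infinity> then 1
     else (real_of_ereal q0 - 1) / (real_of_ereal q0 - p))"

text \<open>The two expressions agree at the critical exponent, so the case split is unambiguous.\<close>

lemma sharp_exponent_critical:
  assumes "1 \<le> p0" "p0 < 2" "2 < q0" "p = critical_exponent p0 q0"
  shows "1 / (p - p0) =
    (if q0 = \<infinity> then 1 else (real_of_ereal q0 - 1) / (real_of_ereal q0 - p))"
proof (cases q0)
  case (real r)
  with assms have r: "2 < r" and p: "p = 1 + p0 * (r - 1) / r"
    by (auto simp: critical_exponent_def conj_exponent_def)
  have "p - p0 = (r - p0) / r" "r - p = (r - 1) * (r - p0) / r"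
    using r by (auto simp: p field_simps)
  then have "1 / (p - p0) = (r - 1) / (r - p)"
    using r by simp
  then show ?thesis
    by (simp add: real)
qed (use assms in \<open>auto simp: critical_exponent_def conj_exponent_def\<close>)

end

theory Submission
  imports Defs "HOL-Real_Asymp.Real_Asymp"
begin

text \<open>
  The extremal weights are powers \<open>\<omega>(x) = \<bar>x\<bar>\<^sup>a\<close>, and the extremal functions are powers truncated
  to \<open>[0, 1]\<close>, say \<open>f(x) = x\<^sup>-\<^sup>b\<close> and \<open>g(x) = x\<^sup>-\<^sup>d\<close>. Choose the exponents so that \<open>b + d = 1 - \<epsilon>\<close>
  and \<open>a - b p = \<epsilon> - 1\<close>. Then both integrands in the weighted norms are \<open>x\<^bsup>\<epsilon>-1\<^esup>\<close>,
  the product of the two norms is \<open>\<epsilon>\<^sup>-\<^sup>1\<close>, and on \<open>I = [0, 2\<^sup>-\<^sup>n]\<close> the term of the sparse form is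
  at least \<open>2\<^bsup>-n\<epsilon>\<^esup>\<close>, so that summing the geometric series also produces \<open>\<epsilon>\<^sup>-\<^sup>1\<close>.
  These two factors cancel. What remains is the gain by which the local averages of one of the two
  functions exceed their value at the right endpoint of \<open>I\<close>, and this gain has to be matched with
  the weight constant. Write \<open>q = p / p\<^sub>0\<close>, \<open>s = (q\<^sub>0 / p)'\<close> and \<open>\<rho> = q\<^sub>0'\<close>.

  One choice lets \<open>a = (q - 1)(1 - \<epsilon>)\<close> approach the upper end of the range in which the Muckenhoupt
  constant is finite. The weight constant is then of order \<open>\<epsilon>\<^bsup>-(q-1)\<^esup>\<close>, whereas \<open>b p\<^sub>0 = 1 - \<epsilon>\<close> makes
  the averages of \<open>f\<^bsup>p0\<^esup>\<close> large by a factor \<open>1 / \<epsilon>\<close>. This gains a factor \<open>\<epsilon>\<^bsup>-1/p0\<^esup>\<close>,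
  and \<open>(q - 1) / (p - p\<^sub>0) = 1 / p\<^sub>0\<close>.

  The other choice lets \<open>a = - (1 - \<epsilon>) / s\<close> approach the lower end of the range in which \<open>\<omega>\<^sup>s\<close> is
  locally integrable. The weight constant is then of order \<open>\<epsilon>\<^bsup>-1/s\<^esup>\<close>, whereas
  \<open>d \<rho> = 1 - \<epsilon>\<close> makes the averages of \<open>g\<^sup>\<rho>\<close> large. This gains a factor \<open>\<epsilon>\<^bsup>-1/\<rho>\<^esup>\<close>,
  and \<open>1 / \<rho>\<close> is \<open>1 / s\<close> times \<open>(q\<^sub>0 - 1) / (q\<^sub>0 - p)\<close>.

  The first choice gives the exponent required below the critical exponent, the second the one
  required above it. Both rest on \<open>average_power_comparable\<close>, which bounds the weight constants of a
  power from above, and on \<open>sparse_form_truncated_power_ge\<close>; the common final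
  computation is \<open>power_weights_sharp\<close>.
\<close>

section \<open>Real powers of extended nonnegative numbers\<close>

lemma epowr_ennreal: "0 \<le> x \<Longrightarrow> ennreal x epowr t = ennreal (x powr t)"
  by (simp add: epowr_def)

lemma epowr_mono:
  assumes "0 \<le> t" "x \<le> y"
  shows "x epowr t \<le> y epowr t"
proof (cases "y = \<infinity>")
  case False
  then have "enn2real x \<le> enn2real y"
    using assms(2) by (intro enn2real_mono) (auto simp: top.not_eq_extremum)
  with False assms show ?thesis
    by (auto simp: epowr_def top_unique intro!: ennreal_leI powr_mono2)
qed (simp add: epowr_def)

lemma ennreal_divide_mono: "a \<le> b \<Longrightarrow> d \<le> c \<Longrightarrow> a / c \<le> b / (d :: ennreal)"
proof -
  have "inverse c \<le> inverse d" if le: "d \<le> c"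
  proof (cases "d = 0 \<or> c = top")
    case False
    then obtain c' d' where "c = ennreal c'" "d = ennreal d'" "0 < d'" "0 \<le> c'"
      using le by (cases c; cases d) (auto simp: top_unique less_le)
    with le show ?thesis
      by (auto simp: inverse_ennreal intro!: ennreal_leI le_imp_inverse_le)
  qed auto
  then show "a \<le> b \<Longrightarrow> d \<le> c \<Longrightarrow> a / c \<le> b / d"
    unfolding divide_ennreal_def by (intro mult_mono) auto
qed

section \<open>Averages of powers over intervals\<close>

text \<open>Up to the factor \<open>1 + a\<close> this is the odd antiderivative of \<open>\<bar>x\<bar>\<^sup>a\<close>. Writing it with
  the factor \<open>x\<close> instead of a sign makes it linear in \<open>x\<close> once \<open>\<bar>x\<bar>\<^sup>a\<close> has been estimated.\<close>

definition signed_power :: "real \<Rightarrow> real \<Rightarrow> real" where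
  "signed_power a x = x * \<bar>x\<bar> powr a"

lemma signed_power_minus: "signed_power a (- x) = - signed_power a x"
  by (simp add: signed_power_def)

text \<open>The fundamental theorem of calculus tolerates the one point \<open>0\<close> at which the antiderivative
  may fail to be differentiable; the antiderivative is continuous there because \<open>a > -1\<close>.\<close>

lemma power_has_integral:
  fixes a u v :: real
  assumes "-1 < a" "u \<le> v"
  shows "((\<lambda>x. \<bar>x\<bar> powr a) has_integral
    (signed_power a v - signed_power a u) / (1 + a)) {u..v}"
proof -
  define F where "F x = signed_power a x / (1 + a)" for x
  have Fpos: "F x = x powr (1 + a) / (1 + a)" if "0 \<le> x" for x
    using that assms by (cases "x = 0") (auto simp: F_def signed_power_def powr_add)
  have Fneg: "F x = - ((- x) powr (1 + a) / (1 + a))" if "x \<le> 0" for x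
    using Fpos[of "- x"] that by (simp add: F_def signed_power_minus)
  have deriv: "(F has_vector_derivative \<bar>x\<bar> powr a) (at x)" if "x \<noteq> 0" for x
  proof (cases "0 < x")
    case True
    have "((\<lambda>x. x powr (1 + a) / (1 + a)) has_field_derivative \<bar>x\<bar> powr a) (at x)"
      using True assms by (auto intro!: derivative_eq_intros)
    then have "((\<lambda>x. x powr (1 + a) / (1 + a)) has_vector_derivative \<bar>x\<bar> powr a) (at x)"
      by (simp add: has_real_derivative_iff_has_vector_derivative)
    then show ?thesis
      by (rule has_vector_derivative_transform_within_open[of _ _ _ "{0<..}"])
        (use True Fpos in auto)
  next
    case False
    with that have x: "x < 0" by simp
    have "((\<lambda>x. - ((- x) powr (1 + a) / (1 + a))) has_field_derivative \<bar>x\<bar> powr a) (at x)"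
      using x assms by (auto intro!: derivative_eq_intros)
    then have "((\<lambda>x. - ((- x) powr (1 + a) / (1 + a))) has_vector_derivative \<bar>x\<bar> powr a) (at x)"
      by (simp add: has_real_derivative_iff_has_vector_derivative)
    then show ?thesis
      by (rule has_vector_derivative_transform_within_open[of _ _ _ "{..<0}"])
        (use x Fneg in auto)
  qed
  have Fabs: "F x = (max x 0 powr (1 + a) - max (- x) 0 powr (1 + a)) / (1 + a)" for x
    using Fpos[of x] Fneg[of x] by (auto simp: max_def)
  have "continuous_on {u..v} F"
    unfolding Fabs using assms
    by (intro continuous_intros continuous_on_powr') auto
  with deriv assms have "((\<lambda>x. \<bar>x\<bar> powr a) has_integral F v - F u) {u..v}"
    by (intro fundamental_theorem_of_calculus_interior_strong[of "{0}"]) auto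
  then show ?thesis
    by (simp add: F_def diff_divide_distrib)
qed

lemma nn_integral_power:
  assumes "-1 < a" "u \<le> v"
  shows "(\<integral>\<^sup>+x\<in>{u..v}. ennreal (\<bar>x\<bar> powr a) \<partial>lebesgue) =
    ennreal ((signed_power a v - signed_power a u) / (1 + a))"
  using nn_integral_has_integral_lebesgue'[OF _ power_has_integral[OF assms]]
  by (simp add: nn_integral_completion)

lemma average_power:
  assumes "-1 < a" "u < v"
  shows "average {u..v} (\<lambda>x. \<bar>x\<bar> powr a) =
    ennreal ((signed_power a v - signed_power a u) / ((1 + a) * (v - u)))"
proof -
  have I: "((\<lambda>x. \<bar>x\<bar> powr a) has_integral
    (signed_power a v - signed_power a u) / (1 + a)) {u..v}"
    using assms by (intro power_has_integral) auto
  have "0 \<le> (signed_power a v - signed_power a u) / (1 + a)"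
    by (rule has_integral_nonneg[OF I]) simp
  then show ?thesis
    using assms by (simp add: average_def nn_integral_power divide_ennreal divide_divide_eq_left)
qed

lemma average_mono_AE:
  assumes "AE x in lebesgue. x \<in> B \<longrightarrow> h x \<le> k x"
  shows "average B h \<le> average B k"
  unfolding average_def
proof (intro divide_right_mono_ennreal nn_integral_mono_AE)
  show "AE x in lebesgue. ennreal (h x) * indicator B x \<le> ennreal (k x) * indicator B x"
    using assms by eventually_elim (auto simp: indicator_def intro: ennreal_leI)
qed

lemma average_cong:
  assumes "\<And>x. x \<in> B \<Longrightarrow> h x = k x"
  shows "average B h = average B k"
  using assms by (intro antisym average_mono_AE) auto

lemma average_const:
  assumes "u < v" "0 \<le> c"
  shows "average {u..v} (\<lambda>_. c) = ennreal c"
  using assms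
  by (simp add: average_def nn_integral_cmult_indicator divide_ennreal flip: ennreal_mult)

lemma AE_lebesgue_neq: "AE x in lebesgue. x \<noteq> (c::real)"
  by (rule AE_I[of _ _ "{c}"]) (auto simp: lmeasurable_iff_integrable)

text \<open>Whether the endpoints belong to an interval does not affect averages, so every supremum over
  bounded intervals can be taken over compact ones.\<close>

lemma bounded_interval_endpoints:
  assumes "B \<in> bounded_intervals"
  obtains u v where "u < v" "\<And>h. average B h = average {u..v} h"
proof -
  have B: "is_interval B" "bounded B" "0 < measure lebesgue B"
    using assms by (auto simp: bounded_intervals_def)
  have ne: "B \<noteq> {}" using B(3) by auto
  define u v where "u = Inf B" and "v = Sup B"
  have bd: "bdd_below B" "bdd_above B"
    using B(2) bounded_imp_bdd_below bounded_imp_bdd_above by auto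
  have sub: "B \<subseteq> {u..v}"
    using bd by (auto simp: u_def v_def intro: cInf_lower cSup_upper)
  have sup: "{u<..<v} \<subseteq> B"
  proof
    fix x assume x: "x \<in> {u<..<v}"
    obtain y where y: "y \<in> B" "y < x"
      using x ne bd by (auto simp: u_def cInf_less_iff)
    obtain z where z: "z \<in> B" "x < z"
      using x ne bd by (auto simp: v_def less_cSup_iff)
    show "x \<in> B"
      using B(1) y z unfolding is_interval_1 by (meson less_imp_le)
  qed
  have ae: "AE x in lebesgue. x \<in> B \<longleftrightarrow> x \<in> {u..v}"
    using AE_lebesgue_neq[of u] AE_lebesgue_neq[of v]
  proof eventually_elim
    case (elim x)
    then show ?case using sub sup by force
  qed
  have uv: "u < v"
  proof (rule ccontr)
    assume "\<not> u < v"
    then have "B \<subseteq> {u}" using sub by auto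
    then have "B \<in> null_sets lebesgue"
      by (rule null_sets_completion_subset) auto
    with B(3) show False by (simp add: measure_eq_0_null_sets)
  qed
  have meas: "B \<in> sets lebesgue"
    using B(3) by (auto simp: measure_notin_sets intro: ccontr)
  have "emeasure lebesgue B = emeasure lebesgue {u..v}"
    using ae meas by (intro emeasure_eq_AE) auto
  moreover have "(\<integral>\<^sup>+x\<in>B. ennreal (h x) \<partial>lebesgue) = (\<integral>\<^sup>+x\<in>{u..v}. ennreal (h x) \<partial>lebesgue)" for h
  proof (rule nn_integral_cong_AE)
    show "AE x in lebesgue. ennreal (h x) * indicator B x = ennreal (h x) * indicator {u..v} x"
      using ae by eventually_elim (auto simp: indicator_def)
  qed
  ultimately have "\<And>h. average B h = average {u..v} h"
    by (simp add: average_def)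
  with uv show ?thesis using that by blast
qed

text \<open>For \<open>u \<ge> 0\<close> both estimates hold without the factor \<open>2\<close>, by comparing \<open>\<bar>u\<bar>\<^sup>a\<close> with \<open>v\<^sup>a\<close>.
  If \<open>0\<close> lies inside the interval, the part to the right of \<open>0\<close> accounts for at least half of both
  the length and the integral.\<close>

lemma signed_power_comparable:
  fixes a u v :: real
  assumes "\<bar>u\<bar> \<le> v" "u < v"
  shows "0 \<le> a \<Longrightarrow> v powr a * (v - u) \<le> 2 * (signed_power a v - signed_power a u)"
    and "-1 < a \<Longrightarrow> a \<le> 0 \<Longrightarrow> signed_power a v - signed_power a u \<le> 2 * (v powr a * (v - u))"
proof -
  have v: "0 < v" using assms by auto
  show "v powr a * (v - u) \<le> 2 * (signed_power a v - signed_power a u)" if a: "0 \<le> a"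
  proof (cases "0 \<le> u")
    case True
    have "\<bar>u\<bar> powr a * u \<le> v powr a * u"
      using True assms a by (intro mult_right_mono powr_mono2) auto
    then have "v powr a * (v - u) \<le> 1 * (signed_power a v - signed_power a u)"
      using v by (simp add: signed_power_def algebra_simps)
    also have "\<dots> \<le> 2 * (signed_power a v - signed_power a u)"
    proof (rule mult_right_mono)
      have "0 \<le> v powr a * (v - u)" using assms by simp
      also note \<open>v powr a * (v - u) \<le> 1 * (signed_power a v - signed_power a u)\<close>
      finally show "0 \<le> signed_power a v - signed_power a u" by simp
    qed simp
    finally show ?thesis .
  next
    case False
    have "v powr a * (v - u) \<le> v powr a * (2 * v)"
      using assms by (intro mult_left_mono) auto
    moreover have "0 \<le> - u * \<bar>u\<bar> powr a"
      using False by (intro mult_nonneg_nonneg) auto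
    ultimately show ?thesis
      using v by (simp add: signed_power_def algebra_simps)
  qed
  show "signed_power a v - signed_power a u \<le> 2 * (v powr a * (v - u))" if a: "-1 < a" "a \<le> 0"
  proof (cases "0 < u")
    case True
    have "v powr a * u \<le> \<bar>u\<bar> powr a * u"
      using True assms a by (intro mult_right_mono powr_mono2') auto
    then have "signed_power a v - signed_power a u \<le> 1 * (v powr a * (v - u))"
      using v by (simp add: signed_power_def algebra_simps)
    also have "\<dots> \<le> 2 * (v powr a * (v - u))"
      using assms by (intro mult_right_mono) auto
    finally show ?thesis .
  next
    case False
    have eq: "\<bar>x\<bar> * \<bar>x\<bar> powr a = \<bar>x\<bar> powr (1 + a)" for x :: real
      using a by (cases "x = 0") (auto simp: powr_add)
    have "\<bar>u\<bar> powr (1 + a) \<le> \<bar>v\<bar> powr (1 + a)"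
      using assms a by (intro powr_mono2) auto
    then have "- signed_power a u \<le> v powr a * v"
      using False v eq[of u] eq[of v] by (simp add: signed_power_def algebra_simps)
    moreover have "v powr a * v \<le> v powr a * (v - u)"
      using False by (intro mult_left_mono) auto
    ultimately show ?thesis
      using v by (simp add: signed_power_def algebra_simps)
  qed
qed

text \<open>One of the two bounds is trivial for each sign of \<open>a\<close>, since \<open>v\<^sup>a\<close> is the maximum or the
  minimum of \<open>\<bar>x\<bar>\<^sup>a\<close> on \<open>[u, v]\<close>. The other one comes from the antiderivative.\<close>

lemma average_power_comparable_right:
  fixes a u v :: real
  assumes "-1 < a" "\<bar>u\<bar> \<le> v" "u < v"
  shows "average {u..v} (\<lambda>x. \<bar>x\<bar> powr a) \<le> ennreal (max 1 (2 / (1 + a)) * v powr a)"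
    and "ennreal (v powr a / (2 * (1 + \<bar>a\<bar>))) \<le> average {u..v} (\<lambda>x. \<bar>x\<bar> powr a)"
proof -
  have v: "0 < v" and pos: "0 < (1 + a) * (v - u)" using assms by auto
  note avg = average_power[OF assms(1,3)]
  show "average {u..v} (\<lambda>x. \<bar>x\<bar> powr a) \<le> ennreal (max 1 (2 / (1 + a)) * v powr a)"
  proof (cases "0 \<le> a")
    case True
    have "average {u..v} (\<lambda>x. \<bar>x\<bar> powr a) \<le> average {u..v} (\<lambda>_. v powr a)"
      using assms True by (intro average_mono_AE AE_I2 impI powr_mono2) auto
    also have "\<dots> = ennreal (1 * v powr a)"
      using assms by (simp add: average_const)
    also have "\<dots> \<le> ennreal (max 1 (2 / (1 + a)) * v powr a)"
      by (intro ennreal_leI mult_right_mono) auto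
    finally show ?thesis .
  next
    case False
    have "(signed_power a v - signed_power a u) / ((1 + a) * (v - u)) \<le>
        2 * (v powr a * (v - u)) / ((1 + a) * (v - u))"
      using signed_power_comparable(2)[OF assms(2,3)] False assms pos
      by (intro divide_right_mono) auto
    also have "\<dots> = 2 / (1 + a) * v powr a"
      using assms by (simp add: divide_simps)
    also have "\<dots> \<le> max 1 (2 / (1 + a)) * v powr a"
      by (intro mult_right_mono) auto
    finally show ?thesis
      unfolding avg by (rule ennreal_leI)
  qed
  show "ennreal (v powr a / (2 * (1 + \<bar>a\<bar>))) \<le> average {u..v} (\<lambda>x. \<bar>x\<bar> powr a)"
  proof (cases "0 \<le> a")
    case True
    have "v powr a / (2 * (1 + \<bar>a\<bar>)) = v powr a * (v - u) / 2 / ((1 + a) * (v - u))"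
      using True assms by (simp add: divide_simps)
    also have "\<dots> \<le> (signed_power a v - signed_power a u) / ((1 + a) * (v - u))"
      using signed_power_comparable(1)[OF assms(2,3) True] pos
      by (intro divide_right_mono) auto
    finally show ?thesis
      unfolding avg by (rule ennreal_leI)
  next
    case False
    have "v powr a / (2 * (1 + \<bar>a\<bar>)) \<le> v powr a / 1"
      by (intro divide_left_mono) auto
    then have "ennreal (v powr a / (2 * (1 + \<bar>a\<bar>))) \<le> average {u..v} (\<lambda>_. v powr a)"
      using assms by (simp add: average_const ennreal_leI)
    also have "\<dots> \<le> average {u..v} (\<lambda>x. \<bar>x\<bar> powr a)"
    proof (rule average_mono_AE)
      \<comment> \<open>The bound fails at \<open>x = 0\<close>, where \<open>0 powr a = 0\<close> also for negative \<open>a\<close>.\<close>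
      show "AE x in lebesgue. x \<in> {u..v} \<longrightarrow> v powr a \<le> \<bar>x\<bar> powr a"
        using AE_lebesgue_neq[of 0]
        by eventually_elim (use False assms in \<open>auto intro!: powr_mono2'\<close>)
    qed
    finally show ?thesis .
  qed
qed

text \<open>The average of \<open>\<bar>x\<bar>\<^sup>a\<close> over an interval is comparable to \<open>M\<^sup>a\<close>, where \<open>M\<close> is the largest
  distance of a point of the interval from \<open>0\<close>. As the powers of \<open>M\<close> cancel in the weight constants,
  these are bounded by the constants found here. The upper constant exceeds \<open>2\<close> only for
  \<open>a < 0\<close>, and it blows up as \<open>a\<close> tends to \<open>-1\<close>.\<close>

lemma average_power_comparable:
  fixes a u v :: real
  assumes "-1 < a" "u < v"
  defines "M \<equiv> max \<bar>u\<bar> \<bar>v\<bar>"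
  shows "average {u..v} (\<lambda>x. \<bar>x\<bar> powr a) \<le> ennreal (max 1 (2 / (1 + a)) * M powr a)"
    and "ennreal (M powr a / (2 * (1 + \<bar>a\<bar>))) \<le> average {u..v} (\<lambda>x. \<bar>x\<bar> powr a)"
proof -
  obtain u' v' where uv: "\<bar>u'\<bar> \<le> v'" "u' < v'" "M = v'"
      "average {u..v} (\<lambda>x. \<bar>x\<bar> powr a) = average {u'..v'} (\<lambda>x. \<bar>x\<bar> powr a)"
  proof (cases "\<bar>u\<bar> \<le> v")
    case True
    then show ?thesis using that[of u v] assms by auto
  next
    case False
    have "average {u..v} (\<lambda>x. \<bar>x\<bar> powr a) = average {- v..- u} (\<lambda>x. \<bar>x\<bar> powr a)"
      using assms by (simp add: average_power signed_power_minus)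
    then show ?thesis using that[of "- v" "- u"] False assms by auto
  qed
  show "average {u..v} (\<lambda>x. \<bar>x\<bar> powr a) \<le> ennreal (max 1 (2 / (1 + a)) * M powr a)"
    "ennreal (M powr a / (2 * (1 + \<bar>a\<bar>))) \<le> average {u..v} (\<lambda>x. \<bar>x\<bar> powr a)"
    unfolding uv(3,4) using average_power_comparable_right[OF assms(1) uv(1,2)] by auto
qed

lemma average_power_from_0:
  assumes "-1 < a" "0 < h"
  shows "average {0..h} (\<lambda>x. \<bar>x\<bar> powr a) = ennreal (h powr a / (1 + a))"
  using assms by (simp add: average_power signed_power_def)

lemma average_power_from_0_ge:
  assumes "0 \<le> e" "0 < h"
  shows "ennreal (h powr - e) \<le> average {0..h} (\<lambda>x. \<bar>x\<bar> powr - e)"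
proof -
  have "ennreal (h powr - e) = average {0..h} (\<lambda>_. h powr - e)"
    using assms by (simp add: average_const)
  also have "\<dots> \<le> average {0..h} (\<lambda>x. \<bar>x\<bar> powr - e)"
  proof (rule average_mono_AE)
    show "AE x in lebesgue. x \<in> {0..h} \<longrightarrow> h powr - e \<le> \<bar>x\<bar> powr - e"
      using AE_lebesgue_neq[of 0]
      by eventually_elim (use assms in \<open>auto intro!: powr_mono2'\<close>)
  qed
  finally show ?thesis .
qed

section \<open>Conjugate exponents\<close>

lemma conj_exponent_real: "conj_exponent (ereal q) = q / (q - 1)"
  by (simp add: conj_exponent_def)

lemma one_minus_conj_exponent: "1 < q \<Longrightarrow> 1 - conj_exponent (ereal q) = - (1 / (q - 1))"
  by (simp add: conj_exponent_real field_simps)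

text \<open>In terms of \<open>\<rho> = q\<^sub>0'\<close>, the exponent \<open>s = (q\<^sub>0 / p)'\<close> satisfies a relation that no longer
  distinguishes the cases \<open>q\<^sub>0 < \<infinity>\<close> and \<open>q\<^sub>0 = \<infinity>\<close>.\<close>

lemma exponent_relations:
  fixes p :: real and q0 :: ereal
  assumes "2 < q0" "0 < p" "ereal p < q0"
  defines "\<rho> \<equiv> conj_exponent q0" and "s \<equiv> conj_exponent (q0 / ereal p)"
  shows "1 \<le> \<rho>" and "1 \<le> s" and "1 / s = 1 - p + p / \<rho>"
    and "\<not> p \<le> critical_exponent p0 q0 \<Longrightarrow> 1 / s * sharp_exponent p0 q0 p = 1 / \<rho>"
proof -
  have "1 \<le> \<rho> \<and> 1 \<le> s \<and> 1 / s = 1 - p + p / \<rho> \<and>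
    (\<not> p \<le> critical_exponent p0 q0 \<longrightarrow> 1 / s * sharp_exponent p0 q0 p = 1 / \<rho>)"
  proof (cases q0)
    case (real r)
    then have r: "2 < r" "p < r" using assms by auto
    have \<rho>: "\<rho> = r / (r - 1)" using real by (simp add: \<rho>_def conj_exponent_real)
    have "s = r / p / (r / p - 1)"
      using real assms by (simp add: s_def conj_exponent_real)
    also have "\<dots> = r / (r - p)" using r assms by (simp add: field_simps)
    finally have s: "s = r / (r - p)" .
    show ?thesis
      using r assms(2) by (auto simp: \<rho> s real sharp_exponent_def field_simps)
  next
    case PInf
    then have "\<rho> = 1" "s = 1" using assms by (auto simp: \<rho>_def s_def conj_exponent_def)
    then show ?thesis using PInf by (simp add: sharp_exponent_def)
  qed (use assms in auto)
  then show "1 \<le> \<rho>" "1 \<le> s" "1 / s = 1 - p + p / \<rho>"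
    "\<not> p \<le> critical_exponent p0 q0 \<Longrightarrow> 1 / s * sharp_exponent p0 q0 p = 1 / \<rho>"
    by blast+
qed

section \<open>Weight constants of powers\<close>

text \<open>Upper bounds use the comparison with \<open>M\<^sup>a\<close> on all intervals; for the lower bounds the single
  interval \<open>[0, 1]\<close> is enough.\<close>

lemma unit_interval_bounded_interval: "{0..1} \<in> bounded_intervals"
  by (auto simp: bounded_intervals_def)

lemma A_const_power_le:
  assumes "1 < q" "-1 < a" "a < q - 1"
  shows "A_const q (\<lambda>x. \<bar>x\<bar> powr a) \<le>
    ennreal (max 1 (2 / (1 + a)) * max 1 (2 / (1 - a / (q - 1))) powr (q - 1))"
  unfolding A_const_def
proof (rule SUP_least)
  fix B assume "B \<in> bounded_intervals"
  then obtain u v where uv: "u < v" "\<And>h. average B h = average {u..v} h"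
    by (rule bounded_interval_endpoints) blast
  define M where "M = max \<bar>u\<bar> \<bar>v\<bar>"
  define a' where "a' = - (a / (q - 1))"
  have a': "-1 < a'" using assms by (simp add: a'_def field_simps)
  have M: "0 < M" using uv by (auto simp: M_def)
  have "average B (\<lambda>x. \<bar>x\<bar> powr a) *
      average B (\<lambda>x. (\<bar>x\<bar> powr a) powr (1 - conj_exponent (ereal q))) epowr (q - 1)
    = average {u..v} (\<lambda>x. \<bar>x\<bar> powr a) * average {u..v} (\<lambda>x. \<bar>x\<bar> powr a') epowr (q - 1)"
    using assms by (simp add: uv powr_powr one_minus_conj_exponent a'_def)
  also have "\<dots> \<le> ennreal (max 1 (2 / (1 + a)) * M powr a) *
      ennreal (max 1 (2 / (1 + a')) * M powr a') epowr (q - 1)"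
    unfolding M_def using assms a' uv
    by (intro mult_mono epowr_mono average_power_comparable) auto
  also have "\<dots> = ennreal (max 1 (2 / (1 + a)) * M powr a *
      (max 1 (2 / (1 + a')) powr (q - 1) * M powr (a' * (q - 1))))"
    by (simp add: epowr_ennreal powr_mult powr_powr flip: ennreal_mult)
  also have "a' * (q - 1) = - a"
    using assms by (simp add: a'_def)
  also have "max 1 (2 / (1 + a)) * M powr a * (max 1 (2 / (1 + a')) powr (q - 1) * M powr - a)
      = max 1 (2 / (1 + a)) * max 1 (2 / (1 - a / (q - 1))) powr (q - 1)"
    using M by (simp add: a'_def powr_minus field_simps)
  finally show "average B (\<lambda>x. \<bar>x\<bar> powr a) *
      average B (\<lambda>x. (\<bar>x\<bar> powr a) powr (1 - conj_exponent (ereal q))) epowr (q - 1)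
    \<le> ennreal (max 1 (2 / (1 + a)) * max 1 (2 / (1 - a / (q - 1))) powr (q - 1))" .
qed

lemma A_const_power_ge:
  assumes "1 < q" "-1 < a" "a < q - 1"
  shows "ennreal (1 / (1 + a) * (1 / (1 - a / (q - 1))) powr (q - 1)) \<le>
    A_const q (\<lambda>x. \<bar>x\<bar> powr a)"
proof -
  define a' where "a' = - (a / (q - 1))"
  have a': "-1 < a'" using assms by (simp add: a'_def field_simps)
  have "ennreal (1 / (1 + a) * (1 / (1 - a / (q - 1))) powr (q - 1)) =
      average {0..1} (\<lambda>x. \<bar>x\<bar> powr a) * average {0..1} (\<lambda>x. \<bar>x\<bar> powr a') epowr (q - 1)"
    using assms a'
    by (simp add: average_power_from_0 epowr_ennreal a'_def flip: ennreal_mult)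
  also have "\<dots> = average {0..1} (\<lambda>x. \<bar>x\<bar> powr a) *
      average {0..1} (\<lambda>x. (\<bar>x\<bar> powr a) powr (1 - conj_exponent (ereal q))) epowr (q - 1)"
    using assms by (simp add: powr_powr one_minus_conj_exponent a'_def)
  also have "\<dots> \<le> A_const q (\<lambda>x. \<bar>x\<bar> powr a)"
    unfolding A_const_def by (rule SUP_upper[OF unit_interval_bounded_interval])
  finally show ?thesis .
qed

lemma RH_const_power_le:
  assumes "1 \<le> s" "-1 < a" "-1 < a * s"
  shows "RH_const s (\<lambda>x. \<bar>x\<bar> powr a) \<le>
    ennreal (max 1 (2 / (1 + a * s)) powr (1 / s) * (2 * (1 + \<bar>a\<bar>)))"
proof (cases "s = 1")
  case True
  have "1 * 1 \<le> max 1 (2 / (1 + a * s)) powr (1 / s) * (2 * (1 + \<bar>a\<bar>))"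
    using assms by (intro mult_mono ge_one_powr_ge_zero) auto
  then show ?thesis
    using True by (simp add: RH_const_def flip: ennreal_1 del: ennreal_1)
next
  case False
  have "(SUP B\<in>bounded_intervals. average B (\<lambda>x. (\<bar>x\<bar> powr a) powr s) epowr (1 / s) /
      average B (\<lambda>x. \<bar>x\<bar> powr a)) \<le>
    ennreal (max 1 (2 / (1 + a * s)) powr (1 / s) * (2 * (1 + \<bar>a\<bar>)))"
  proof (rule SUP_least)
    fix B assume "B \<in> bounded_intervals"
    then obtain u v where uv: "u < v" "\<And>h. average B h = average {u..v} h"
      by (rule bounded_interval_endpoints) blast
    define M where "M = max \<bar>u\<bar> \<bar>v\<bar>"
    have M: "0 < M" using uv by (auto simp: M_def)
    have "average B (\<lambda>x. (\<bar>x\<bar> powr a) powr s) epowr (1 / s) / average B (\<lambda>x. \<bar>x\<bar> powr a)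
      = average {u..v} (\<lambda>x. \<bar>x\<bar> powr (a * s)) epowr (1 / s) /
        average {u..v} (\<lambda>x. \<bar>x\<bar> powr a)"
      by (simp add: uv powr_powr)
    also have "\<dots> \<le> ennreal (max 1 (2 / (1 + a * s)) * M powr (a * s)) epowr (1 / s) /
        ennreal (M powr a / (2 * (1 + \<bar>a\<bar>)))"
      unfolding M_def using assms uv
      by (intro ennreal_divide_mono epowr_mono average_power_comparable) auto
    also have "\<dots> = ennreal ((max 1 (2 / (1 + a * s)) powr (1 / s) * M powr (a * s * (1 / s))) /
        (M powr a / (2 * (1 + \<bar>a\<bar>))))"
      using M by (subst epowr_ennreal) (auto simp: powr_mult powr_powr divide_ennreal)
    also have "a * s * (1 / s) = a" using assms by simp
    also have "max 1 (2 / (1 + a * s)) powr (1 / s) * M powr a / (M powr a / (2 * (1 + \<bar>a\<bar>)))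
      = max 1 (2 / (1 + a * s)) powr (1 / s) * (2 * (1 + \<bar>a\<bar>))"
      using M by simp
    finally show "average B (\<lambda>x. (\<bar>x\<bar> powr a) powr s) epowr (1 / s) /
        average B (\<lambda>x. \<bar>x\<bar> powr a)
      \<le> ennreal (max 1 (2 / (1 + a * s)) powr (1 / s) * (2 * (1 + \<bar>a\<bar>)))" .
  qed
  with False show ?thesis by (simp add: RH_const_def)
qed

lemma RH_const_power_ge:
  assumes "1 \<le> s" "-1 < a" "-1 < a * s"
  shows "ennreal ((1 / (1 + a * s)) powr (1 / s) * (1 + a)) \<le>
    RH_const s (\<lambda>x. \<bar>x\<bar> powr a)"
proof (cases "s = 1")
  case True
  then show ?thesis using assms by (simp add: RH_const_def)
next
  case False
  have "ennreal ((1 / (1 + a * s)) powr (1 / s) * (1 + a)) =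
      average {0..1} (\<lambda>x. \<bar>x\<bar> powr (a * s)) epowr (1 / s) / average {0..1} (\<lambda>x. \<bar>x\<bar> powr a)"
    using assms by (simp add: average_power_from_0 epowr_ennreal divide_ennreal)
  also have "\<dots> = average {0..1} (\<lambda>x. (\<bar>x\<bar> powr a) powr s) epowr (1 / s) /
      average {0..1} (\<lambda>x. \<bar>x\<bar> powr a)"
    by (simp add: powr_powr)
  also have "\<dots> \<le> (SUP B\<in>bounded_intervals. average B (\<lambda>x. (\<bar>x\<bar> powr a) powr s) epowr (1 / s) /
      average B (\<lambda>x. \<bar>x\<bar> powr a))"
    by (rule SUP_upper[OF unit_interval_bounded_interval])
  finally show ?thesis using False by (simp add: RH_const_def)
qed

text \<open>For \<open>a\<close> close to \<open>q - 1\<close> the dual power \<open>- a / (q - 1)\<close> is close to \<open>-1\<close>. Only the second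
  average in the Muckenhoupt constant notices this; the reverse Hoelder constant stays bounded.\<close>

lemma A_extremal_power_bounds:
  fixes q s \<epsilon> :: real
  assumes "1 < q" "1 \<le> s" "0 < \<epsilon>" "\<epsilon> < 1"
  defines "a \<equiv> (q - 1) * (1 - \<epsilon>)"
  shows "ennreal (1 / q * \<epsilon> powr - (q - 1)) \<le> A_const q (\<lambda>x. \<bar>x\<bar> powr a)"
    and "A_const q (\<lambda>x. \<bar>x\<bar> powr a) \<le> ennreal (2 * 2 powr (q - 1) * \<epsilon> powr - (q - 1))"
    and "ennreal (1 / (1 + (q - 1) * s)) \<le> RH_const s (\<lambda>x. \<bar>x\<bar> powr a)"
    and "RH_const s (\<lambda>x. \<bar>x\<bar> powr a) \<le> ennreal (4 * q)"
proof -
  have a: "0 \<le> a" "a < q - 1" "1 - a / (q - 1) = \<epsilon>"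
    using assms by (auto simp: a_def)
  have as: "0 \<le> a * s" "a * s \<le> (q - 1) * s"
    using a assms by auto
  have frac: "2 / (1 + t) \<le> 2" if "0 \<le> t" for t :: real
    using that by (simp add: field_simps)
  have "1 / q * \<epsilon> powr - (q - 1) \<le> 1 / (1 + a) * (1 / (1 - a / (q - 1))) powr (q - 1)"
    unfolding a(3) using a(1,2) assms(1-4)
    by (intro mult_mono divide_left_mono mult_pos_pos) (auto simp: powr_minus_divide powr_divide powr_diff)
  then show "ennreal (1 / q * \<epsilon> powr - (q - 1)) \<le> A_const q (\<lambda>x. \<bar>x\<bar> powr a)"
    by (intro order.trans[OF ennreal_leI A_const_power_ge]) (use a assms(1) in auto)
  have "max 1 (2 / (1 + a)) * max 1 (2 / (1 - a / (q - 1))) powr (q - 1) \<le>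
      2 * (2 * (1 / \<epsilon>)) powr (q - 1)"
    unfolding a(3) using a assms frac[of a]
    by (intro mult_mono powr_mono2) (auto simp: field_simps)
  also have "\<dots> = 2 * 2 powr (q - 1) * \<epsilon> powr - (q - 1)"
    using assms by (simp add: powr_mult powr_divide powr_minus_divide powr_diff)
  finally show "A_const q (\<lambda>x. \<bar>x\<bar> powr a) \<le> ennreal (2 * 2 powr (q - 1) * \<epsilon> powr - (q - 1))"
    by (intro order.trans[OF A_const_power_le ennreal_leI]) (use a assms(1) in auto)
  have "1 / (1 + k) \<le> (1 / (1 + k)) powr (1 / s)" if "0 \<le> k" for k
    using that assms(2) powr_mono'[of "1 / s" 1 "1 / (1 + k)"] by simp
  then have "1 / (1 + (q - 1) * s) \<le> (1 / (1 + (q - 1) * s)) powr (1 / s)"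
    using assms by simp
  also have "\<dots> \<le> (1 / (1 + a * s)) powr (1 / s)"
    using as assms(1-4)
    by (intro powr_mono2 divide_left_mono mult_pos_pos add_pos_nonneg) auto
  also have "\<dots> \<le> (1 / (1 + a * s)) powr (1 / s) * (1 + a)"
    using a by (simp add: mult_le_cancel_left1)
  finally show "ennreal (1 / (1 + (q - 1) * s)) \<le> RH_const s (\<lambda>x. \<bar>x\<bar> powr a)"
    by (intro order.trans[OF ennreal_leI RH_const_power_ge])
      (use a as assms(2) in \<open>auto intro: less_le_trans[of _ 0]\<close>)
  have "max 1 (2 / (1 + a * s)) powr (1 / s) \<le> 2 powr (1 / s)"
    using frac[OF as(1)] assms by (intro powr_mono2) auto
  also have "\<dots> \<le> 2"
    using powr_mono[of "1 / s" 1 2] assms by simp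
  finally have "max 1 (2 / (1 + a * s)) powr (1 / s) * (2 * (1 + \<bar>a\<bar>)) \<le> 2 * (2 * q)"
    using a by (intro mult_mono) auto
  then show "RH_const s (\<lambda>x. \<bar>x\<bar> powr a) \<le> ennreal (4 * q)"
    by (intro order.trans[OF RH_const_power_le ennreal_leI])
      (use a as assms(2) in \<open>auto intro: less_le_trans[of _ 0]\<close>)
qed

text \<open>Here \<open>a s = \<epsilon> - 1\<close>. If \<open>s > 1\<close>, then \<open>a\<close> stays away from \<open>-1\<close>, and only the reverse Hoelder
  constant blows up, like the \<open>1 / s\<close>-th power of the average of \<open>\<omega>\<^sup>s\<close>. For \<open>s = 1\<close> the Muckenhoupt
  constant takes over with the same rate \<open>1 / \<epsilon>\<close>. The multiplicative constants may depend on \<open>s\<close>,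
  and \<open>1 - 1 / s\<close> enters them.\<close>

lemma RH_extremal_power_bounds:
  fixes q s :: real
  assumes "1 < q" "1 \<le> s"
  defines "a \<equiv> \<lambda>\<epsilon>. - (1 / s * (1 - \<epsilon>))"
  obtains l u where "0 < l" "0 < u"
    "\<And>\<epsilon>. 0 < \<epsilon> \<Longrightarrow> \<epsilon> < 1 \<Longrightarrow> A_const q (\<lambda>x. \<bar>x\<bar> powr a \<epsilon>) < \<infinity>"
    "\<And>\<epsilon>. 0 < \<epsilon> \<Longrightarrow> \<epsilon> < 1 \<Longrightarrow> RH_const s (\<lambda>x. \<bar>x\<bar> powr a \<epsilon>) < \<infinity>"
    "\<And>\<epsilon>. 0 < \<epsilon> \<Longrightarrow> \<epsilon> < 1 \<Longrightarrow> ennreal (l * \<epsilon> powr - (1 / s)) \<le>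
      A_const q (\<lambda>x. \<bar>x\<bar> powr a \<epsilon>) * RH_const s (\<lambda>x. \<bar>x\<bar> powr a \<epsilon>)"
    "\<And>\<epsilon>. 0 < \<epsilon> \<Longrightarrow> \<epsilon> < 1 \<Longrightarrow>
      A_const q (\<lambda>x. \<bar>x\<bar> powr a \<epsilon>) * RH_const s (\<lambda>x. \<bar>x\<bar> powr a \<epsilon>)
        \<le> ennreal (u * \<epsilon> powr - (1 / s))"
proof -
  define A0 where "A0 = (1 / (1 + 1 / (q - 1))) powr (q - 1)"
  have "0 < 1 + 1 / (q - 1)" using assms(1,2) by (intro add_pos_pos) auto
  then have A0: "0 < A0" by (simp add: A0_def)
  have a: "a \<epsilon> \<le> 0" "-1 < a \<epsilon>" "a \<epsilon> < q - 1" "- (1 / s) \<le> a \<epsilon>" "a \<epsilon> * s = - (1 - \<epsilon>)"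
    if "0 < \<epsilon>" "\<epsilon> < 1" for \<epsilon>
  proof -
    have "1 / s * (1 - \<epsilon>) \<le> 1 * (1 - \<epsilon>)"
      using that assms(1,2) by (intro mult_right_mono) auto
    then have "- a \<epsilon> \<le> 1 - \<epsilon>" by (simp add: a_def)
    moreover have "1 / s * (1 - \<epsilon>) \<le> 1 / s * 1"
      using that assms(1,2) by (intro mult_left_mono) auto
    then have "- a \<epsilon> \<le> 1 / s" by (simp add: a_def)
    moreover have "0 \<le> 1 / s * (1 - \<epsilon>)"
      using that assms(1,2) by simp
    then have "0 \<le> - a \<epsilon>" by (simp add: a_def)
    ultimately show "a \<epsilon> \<le> 0" "-1 < a \<epsilon>" "a \<epsilon> < q - 1" "- (1 / s) \<le> a \<epsilon>"
      using that assms(1,2) by linarith+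
    show "a \<epsilon> * s = - (1 - \<epsilon>)" using assms(2) by (simp add: a_def)
  qed
  have Age: "ennreal (1 / (1 + a \<epsilon>) * A0) \<le> A_const q (\<lambda>x. \<bar>x\<bar> powr a \<epsilon>)"
    and Ale: "A_const q (\<lambda>x. \<bar>x\<bar> powr a \<epsilon>) \<le> ennreal (2 / (1 + a \<epsilon>) * 2 powr (q - 1))"
    if \<epsilon>: "0 < \<epsilon>" "\<epsilon> < 1" for \<epsilon>
  proof -
    have quot: "0 \<le> - (a \<epsilon> / (q - 1))" "- (a \<epsilon> / (q - 1)) \<le> 1 / (q - 1)"
      using a[OF \<epsilon>] assms(1,2) by (auto simp: divide_simps)
    have "1 / (1 + a \<epsilon>) * A0 \<le> 1 / (1 + a \<epsilon>) * (1 / (1 - a \<epsilon> / (q - 1))) powr (q - 1)"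
      unfolding A0_def using a[OF \<epsilon>] quot assms(1,2)
      by (intro mult_left_mono powr_mono2 divide_left_mono mult_pos_pos) auto
    then show "ennreal (1 / (1 + a \<epsilon>) * A0) \<le> A_const q (\<lambda>x. \<bar>x\<bar> powr a \<epsilon>)"
      using A_const_power_ge[of q "a \<epsilon>"] a[OF \<epsilon>] assms(1,2)
      by (meson ennreal_leI order.trans)
    have "max 1 (2 / (1 + a \<epsilon>)) * max 1 (2 / (1 - a \<epsilon> / (q - 1))) powr (q - 1) \<le>
        2 / (1 + a \<epsilon>) * 2 powr (q - 1)"
      using a[OF \<epsilon>] quot assms(1,2)
      by (intro mult_mono powr_mono2) (auto simp: divide_simps)
    then show "A_const q (\<lambda>x. \<bar>x\<bar> powr a \<epsilon>) \<le> ennreal (2 / (1 + a \<epsilon>) * 2 powr (q - 1))"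
      using A_const_power_le[of q "a \<epsilon>"] a[OF \<epsilon>] assms(1,2)
      by (meson ennreal_leI order.trans)
  qed
  have Afin: "A_const q (\<lambda>x. \<bar>x\<bar> powr a \<epsilon>) < \<infinity>" if "0 < \<epsilon>" "\<epsilon> < 1" for \<epsilon>
    using Ale[OF that] by (rule le_less_trans) simp
  \<comment> \<open>For \<open>s = 1\<close> the reverse Hoelder constant is \<open>1\<close> and the Muckenhoupt constant blows up, since
    \<open>a \<epsilon>\<close> tends to \<open>-1\<close>. For \<open>s > 1\<close> it is the other way round.\<close>
  show ?thesis
  proof (cases "s = 1")
    case True
    have 1: "1 + a \<epsilon> = \<epsilon>" "\<epsilon> powr - (1 / s) = 1 / \<epsilon>" if "0 < \<epsilon>" for \<epsilon>
      using True that by (auto simp: a_def powr_minus_divide)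
    show ?thesis
    proof (rule that[of A0 "2 * 2 powr (q - 1)"])
      fix \<epsilon> :: real assume \<epsilon>: "0 < \<epsilon>" "\<epsilon> < 1"
      show "A_const q (\<lambda>x. \<bar>x\<bar> powr a \<epsilon>) < \<infinity>"
        using Afin[OF \<epsilon>] .
      show "RH_const s (\<lambda>x. \<bar>x\<bar> powr a \<epsilon>) < \<infinity>"
        using True by (simp add: RH_const_def)
      show "ennreal (A0 * \<epsilon> powr - (1 / s)) \<le>
          A_const q (\<lambda>x. \<bar>x\<bar> powr a \<epsilon>) * RH_const s (\<lambda>x. \<bar>x\<bar> powr a \<epsilon>)"
        using Age[OF \<epsilon>] unfolding 1(1)[OF \<epsilon>(1)] 1(2)[OF \<epsilon>(1)]
        using True by (simp add: RH_const_def)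
      show "A_const q (\<lambda>x. \<bar>x\<bar> powr a \<epsilon>) * RH_const s (\<lambda>x. \<bar>x\<bar> powr a \<epsilon>)
          \<le> ennreal (2 * 2 powr (q - 1) * \<epsilon> powr - (1 / s))"
        using Ale[OF \<epsilon>] unfolding 1(1)[OF \<epsilon>(1)] 1(2)[OF \<epsilon>(1)]
        using True by (simp add: RH_const_def)
    qed (use A0 in auto)
  next
    case False
    define \<delta> where "\<delta> = 1 - 1 / s"
    have \<delta>: "0 < \<delta>" "\<delta> \<le> 1" using False assms(1,2) by (auto simp: \<delta>_def)
    have \<delta>a: "\<delta> \<le> 1 + a \<epsilon>" "1 + a \<epsilon> \<le> 1" if "0 < \<epsilon>" "\<epsilon> < 1" for \<epsilon>
      using a[OF that] by (auto simp: \<delta>_def)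
    have Rge: "ennreal (\<epsilon> powr - (1 / s) * \<delta>) \<le> RH_const s (\<lambda>x. \<bar>x\<bar> powr a \<epsilon>)"
      and Rle: "RH_const s (\<lambda>x. \<bar>x\<bar> powr a \<epsilon>) \<le> ennreal (8 * \<epsilon> powr - (1 / s))"
      if \<epsilon>: "0 < \<epsilon>" "\<epsilon> < 1" for \<epsilon>
    proof -
      have as: "1 + a \<epsilon> * s = \<epsilon>" using a(5)[OF \<epsilon>] by simp
      have pw: "(1 / \<epsilon>) powr (1 / s) = \<epsilon> powr - (1 / s)"
        using \<epsilon> by (simp add: powr_divide powr_minus_divide)
      have "\<epsilon> powr - (1 / s) * \<delta> \<le> (1 / (1 + a \<epsilon> * s)) powr (1 / s) * (1 + a \<epsilon>)"
        unfolding as pw using \<delta>a[OF \<epsilon>] by (intro mult_left_mono) auto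
      then show "ennreal (\<epsilon> powr - (1 / s) * \<delta>) \<le> RH_const s (\<lambda>x. \<bar>x\<bar> powr a \<epsilon>)"
        by (rule order.trans[OF ennreal_leI RH_const_power_ge])
          (use a[OF \<epsilon>] \<epsilon> assms(2) in auto)
      have "max 1 (2 / (1 + a \<epsilon> * s)) powr (1 / s) * (2 * (1 + \<bar>a \<epsilon>\<bar>)) \<le>
          (2 * (1 / \<epsilon>)) powr (1 / s) * (2 * 2)"
        unfolding as using a[OF \<epsilon>] \<epsilon> assms(1,2) by (intro mult_mono powr_mono2) auto
      also have "\<dots> \<le> 2 * (1 / \<epsilon>) powr (1 / s) * (2 * 2)"
        using powr_mono[of "1 / s" 1 2] assms(1,2) \<epsilon> unfolding powr_mult
        by (intro mult_right_mono) auto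
      finally have "max 1 (2 / (1 + a \<epsilon> * s)) powr (1 / s) * (2 * (1 + \<bar>a \<epsilon>\<bar>)) \<le>
          8 * \<epsilon> powr - (1 / s)"
        unfolding pw by simp
      then show "RH_const s (\<lambda>x. \<bar>x\<bar> powr a \<epsilon>) \<le> ennreal (8 * \<epsilon> powr - (1 / s))"
        using RH_const_power_le[of s "a \<epsilon>"] a[OF \<epsilon>] \<epsilon> assms(1,2)
        by (auto elim!: order.trans intro!: ennreal_leI)
    qed
    show ?thesis
    proof (rule that[of "A0 * \<delta>" "2 / \<delta> * 2 powr (q - 1) * 8"])
      fix \<epsilon> :: real assume \<epsilon>: "0 < \<epsilon>" "\<epsilon> < 1"
      show "A_const q (\<lambda>x. \<bar>x\<bar> powr a \<epsilon>) < \<infinity>"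
        using Afin[OF \<epsilon>] .
      show "RH_const s (\<lambda>x. \<bar>x\<bar> powr a \<epsilon>) < \<infinity>"
        using Rle[OF \<epsilon>] by (rule le_less_trans) simp
      have "1 * A0 \<le> 1 / (1 + a \<epsilon>) * A0"
        using A0 \<delta> \<delta>a[OF \<epsilon>] by (intro mult_right_mono) auto
      then have "ennreal A0 \<le> A_const q (\<lambda>x. \<bar>x\<bar> powr a \<epsilon>)"
        using Age[OF \<epsilon>] by (auto elim!: order.trans[rotated] intro!: ennreal_leI)
      then have "ennreal A0 * ennreal (\<epsilon> powr - (1 / s) * \<delta>) \<le>
          A_const q (\<lambda>x. \<bar>x\<bar> powr a \<epsilon>) * RH_const s (\<lambda>x. \<bar>x\<bar> powr a \<epsilon>)"
        using Rge[OF \<epsilon>] by (intro mult_mono) auto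
      also have "ennreal A0 * ennreal (\<epsilon> powr - (1 / s) * \<delta>) = ennreal (A0 * \<delta> * \<epsilon> powr - (1 / s))"
        using A0 \<delta> by (simp add: mult_ac flip: ennreal_mult)
      finally show "ennreal (A0 * \<delta> * \<epsilon> powr - (1 / s)) \<le>
          A_const q (\<lambda>x. \<bar>x\<bar> powr a \<epsilon>) * RH_const s (\<lambda>x. \<bar>x\<bar> powr a \<epsilon>)" .
      have "2 / (1 + a \<epsilon>) * 2 powr (q - 1) \<le> 2 / \<delta> * 2 powr (q - 1)"
        using \<delta> \<delta>a[OF \<epsilon>] by (intro mult_right_mono divide_left_mono mult_pos_pos) auto
      then have "A_const q (\<lambda>x. \<bar>x\<bar> powr a \<epsilon>) \<le> ennreal (2 / \<delta> * 2 powr (q - 1))"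
        using Ale[OF \<epsilon>] by (auto elim!: order.trans intro!: ennreal_leI)
      then have "A_const q (\<lambda>x. \<bar>x\<bar> powr a \<epsilon>) * RH_const s (\<lambda>x. \<bar>x\<bar> powr a \<epsilon>)
          \<le> ennreal (2 / \<delta> * 2 powr (q - 1)) * ennreal (8 * \<epsilon> powr - (1 / s))"
        using Rle[OF \<epsilon>] by (intro mult_mono) auto
      also have "\<dots> = ennreal (2 / \<delta> * 2 powr (q - 1) * 8 * \<epsilon> powr - (1 / s))"
        using \<delta> by (simp add: mult.assoc flip: ennreal_mult)
      finally show "A_const q (\<lambda>x. \<bar>x\<bar> powr a \<epsilon>) * RH_const s (\<lambda>x. \<bar>x\<bar> powr a \<epsilon>)
          \<le> ennreal (2 / \<delta> * 2 powr (q - 1) * 8 * \<epsilon> powr - (1 / s))" .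
    qed (use A0 \<delta> in auto)
  qed
qed

section \<open>Truncated powers as test functions\<close>

definition truncated_power :: "real \<Rightarrow> real \<Rightarrow> real" where
  "truncated_power b x = indicator {0..1} x * \<bar>x\<bar> powr - b"

lemma power_measurable: "(\<lambda>x::real. \<bar>x\<bar> powr a) \<in> borel_measurable lebesgue"
  by (rule measurable_completion) measurable

lemma truncated_power_measurable: "truncated_power b \<in> borel_measurable lebesgue"
  unfolding truncated_power_def[abs_def] by (rule measurable_completion) measurable

lemma weight_power: "weight (\<lambda>x. \<bar>x\<bar> powr a)"
  unfolding weight_def using power_measurable AE_lebesgue_neq[of 0] by auto

text \<open>The integrand is \<open>x\<^bsup>\<epsilon>-1\<^esup>\<close> on \<open>[0, 1]\<close>.\<close>

lemma wnorm_truncated_power: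
  assumes "0 < p" "0 < \<epsilon>" "a - b * p = \<epsilon> - 1"
  shows "wnorm p (\<lambda>x. \<bar>x\<bar> powr a) (truncated_power b) = ennreal (\<epsilon> powr - (1 / p))"
proof -
  have eq: "ennreal (\<bar>truncated_power b x\<bar> powr p * \<bar>x\<bar> powr a) =
      ennreal (\<bar>x\<bar> powr (\<epsilon> - 1)) * indicator {0..1} x" for x
  proof -
    have "\<epsilon> - 1 = - b * p + a" using assms by simp
    then have "\<bar>x\<bar> powr (\<epsilon> - 1) = \<bar>x\<bar> powr (- b * p) * \<bar>x\<bar> powr a"
      by (simp only: powr_add)
    then show ?thesis
      by (auto simp: truncated_power_def indicator_def powr_powr)
  qed
  have "(\<integral>\<^sup>+x. ennreal (\<bar>truncated_power b x\<bar> powr p * \<bar>x\<bar> powr a) \<partial>lebesgue) = ennreal (1 / \<epsilon>)"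
    unfolding eq using nn_integral_power[of "\<epsilon> - 1" 0 1] assms
    by (simp add: signed_power_def)
  then show ?thesis
    using assms by (simp add: wnorm_def epowr_ennreal powr_minus_divide powr_divide)
qed

lemma truncated_power_not_AE_zero: "\<not> (AE x in lebesgue. truncated_power b x = 0)"
proof
  assume "AE x in lebesgue. truncated_power b x = 0"
  have "(\<integral>\<^sup>+x. ennreal (\<bar>truncated_power b x\<bar> powr 1 * \<bar>x\<bar> powr b) \<partial>lebesgue) =
      (\<integral>\<^sup>+(x::real). 0 \<partial>lebesgue)"
  proof (rule nn_integral_cong_AE)
    show "AE x in lebesgue. ennreal (\<bar>truncated_power b x\<bar> powr 1 * \<bar>x\<bar> powr b) = 0"
      using \<open>AE x in lebesgue. truncated_power b x = 0\<close> by eventually_elim simp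
  qed
  then have "wnorm 1 (\<lambda>x. \<bar>x\<bar> powr b) (truncated_power b) = 0"
    by (simp add: wnorm_def epowr_def)
  \<comment> \<open>With \<open>p = 1\<close> and the weight \<open>\<bar>x\<bar>\<^sup>b\<close>, however, the norm is the length of \<open>[0, 1]\<close>.\<close>
  then show False
    using wnorm_truncated_power[of 1 1 b b] by simp
qed

section \<open>The sparse form on truncated powers\<close>

text \<open>The ratio \<open>r\<close> of this geometric series satisfies \<open>1 - r \<le> \<epsilon> ln 2 \<le> \<epsilon>\<close>.\<close>

lemma geometric_partial_sums_dyadic:
  fixes \<epsilon> :: real
  assumes "0 < \<epsilon>"
  shows "\<exists>L\<ge>1 / \<epsilon>. (\<lambda>N. \<Sum>n<N. ((1/2) ^ n) powr \<epsilon>) \<longlonglongrightarrow> L"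
proof -
  define r :: real where "r = 2 powr - \<epsilon>"
  have r: "0 < r" "r < 1"
    using assms powr_less_mono[of "- \<epsilon>" 0 2] by (auto simp: r_def)
  have eq: "((1/2) ^ n) powr \<epsilon> = r ^ n" for n
    by (simp add: r_def powr_minus_divide powr_divide power_divide flip: powr_realpow powr_powr)
       (simp add: powr_powr mult.commute)
  have "1 + - \<epsilon> * ln 2 \<le> r"
    unfolding r_def powr_def using exp_ge_add_one_self[of "- \<epsilon> * ln 2"] by simp
  moreover have "\<epsilon> * ln 2 \<le> \<epsilon> * 1"
    using assms ln_2_less_1 by (intro mult_left_mono) auto
  ultimately have "1 - r \<le> \<epsilon>" by simp
  then have "1 / \<epsilon> \<le> 1 / (1 - r)"
    using r assms by (intro divide_left_mono) auto
  moreover have "(\<lambda>N. \<Sum>n<N. ((1/2) ^ n) powr \<epsilon>) \<longlonglongrightarrow> 1 / (1 - r)"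
    unfolding eq using geometric_sums[of r] r by (simp add: sums_def)
  ultimately show ?thesis by blast
qed

lemma sum_le_infsum_ennreal:
  fixes f :: "'a \<Rightarrow> ennreal"
  assumes "finite F" "F \<subseteq> A"
  shows "sum f F \<le> infsum f A"
proof -
  have "infsum f F \<le> infsum f A"
    using assms by (intro infsum_mono_neutral nonneg_summable_on_complete) auto
  then show ?thesis using assms by simp
qed

text \<open>The factors \<open>c1\<close> and \<open>c2\<close> measure how much the averages over \<open>[0, h]\<close> exceed the value at \<open>h\<close>.
  They are independent of \<open>h\<close> by homogeneity, so they come out of the sum, and the interval of length
  \<open>h\<close> contributes \<open>h h\<^sup>-\<^sup>b h\<^sup>-\<^sup>d = h\<^sup>\<epsilon>\<close>.\<close>

lemma sparse_form_truncated_power_ge: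
  assumes "0 < p0" "0 < conj_exponent q0" "0 < \<epsilon>" "b + d = 1 - \<epsilon>" "0 \<le> c1" "0 \<le> c2"
    and f: "\<And>h. 0 < h \<Longrightarrow>
      ennreal (c1 * h powr - (b * p0)) \<le> average {0..h} (\<lambda>x. \<bar>x\<bar> powr - (b * p0))"
    and g: "\<And>h. 0 < h \<Longrightarrow> ennreal (c2 * h powr - (d * conj_exponent q0)) \<le>
      average {0..h} (\<lambda>x. \<bar>x\<bar> powr - (d * conj_exponent q0))"
  shows "ennreal (c1 powr (1 / p0) * c2 powr (1 / conj_exponent q0) / \<epsilon>) \<le>
    sparse_form dyadic_chain p0 q0 (truncated_power b) (truncated_power d)"
proof -
  define \<rho> where "\<rho> = conj_exponent q0"
  define C where "C = c1 powr (1 / p0) * c2 powr (1 / \<rho>)"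
  have C: "0 \<le> C" by (simp add: C_def)
  define T where "T I = emeasure lebesgue I
      * average I (\<lambda>x. \<bar>truncated_power b x\<bar> powr p0) epowr (1 / p0)
      * average I (\<lambda>x. \<bar>truncated_power d x\<bar> powr \<rho>) epowr (1 / \<rho>)" for I
  have avg: "ennreal (c powr (1 / t) * h powr - e) \<le>
      average {0..h} (\<lambda>x. \<bar>truncated_power e x\<bar> powr t) epowr (1 / t)"
    if "0 < h" "h \<le> 1" "0 < t" "0 \<le> c"
      and le: "ennreal (c * h powr - (e * t)) \<le> average {0..h} (\<lambda>x. \<bar>x\<bar> powr - (e * t))"
    for h t c e :: real
  proof -
    have "c powr (1 / t) * h powr - e = (c * h powr - (e * t)) powr (1 / t)"
      using that by (simp add: powr_mult powr_powr)
    then have "ennreal (c powr (1 / t) * h powr - e) = ennreal (c * h powr - (e * t)) epowr (1 / t)"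
      using that by (simp add: epowr_ennreal)
    also have "\<dots> \<le> average {0..h} (\<lambda>x. \<bar>x\<bar> powr - (e * t)) epowr (1 / t)"
      using that by (intro epowr_mono) auto
    also have "average {0..h} (\<lambda>x. \<bar>x\<bar> powr - (e * t)) =
        average {0..h} (\<lambda>x. \<bar>truncated_power e x\<bar> powr t)"
      using that by (intro average_cong) (auto simp: truncated_power_def powr_powr)
    finally show ?thesis .
  qed
  have T: "ennreal (C * h powr \<epsilon>) \<le> T {0..h}" if h: "0 < h" "h \<le> 1" for h
  proof -
    have "\<epsilon> = 1 + - b + - d" using assms by simp
    then have "h powr \<epsilon> = h powr (1 + - b + - d)" by simp
    also have "\<dots> = h * h powr - b * h powr - d"
      unfolding powr_add using h by simp
    finally have "ennreal (C * h powr \<epsilon>) = ennreal h * ennreal (c1 powr (1 / p0) * h powr - b) *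
        ennreal (c2 powr (1 / \<rho>) * h powr - d)"
      using h by (simp add: C_def algebra_simps flip: ennreal_mult)
    also have "\<dots> \<le> T {0..h}"
      unfolding T_def using assms h
      by (intro mult_mono avg) (auto simp: \<rho>_def)
    finally show ?thesis .
  qed
  have inj: "inj (\<lambda>n::nat. {0..(1/2::real) ^ n})"
    by (rule injI) (simp add: Icc_eq_Icc power_one_over)
  have part: "ennreal (C * (\<Sum>n<N. ((1/2) ^ n) powr \<epsilon>)) \<le>
      sparse_form dyadic_chain p0 q0 (truncated_power b) (truncated_power d)" for N :: nat
  proof -
    have "ennreal (C * (\<Sum>n<N. ((1/2) ^ n) powr \<epsilon>)) = (\<Sum>n<N. ennreal (C * ((1/2) ^ n) powr \<epsilon>))"
      using C by (simp add: sum_distrib_left sum_ennreal)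
    also have "\<dots> \<le> (\<Sum>n<N. T {0..(1/2) ^ n})"
      by (intro sum_mono T) (auto simp: power_le_one)
    also have "\<dots> = sum T ((\<lambda>n. {0..(1/2) ^ n}) ` {..<N})"
      by (subst sum.reindex[OF inj_on_subset[OF inj]]) auto
    also have "\<dots> \<le> infsum T dyadic_chain"
      by (intro sum_le_infsum_ennreal) (auto simp: dyadic_chain_def)
    finally show ?thesis
      by (simp add: sparse_form_def T_def[abs_def] \<rho>_def)
  qed
  obtain L where L: "1 / \<epsilon> \<le> L" "(\<lambda>N. \<Sum>n<N. ((1/2) ^ n) powr \<epsilon>) \<longlonglongrightarrow> L"
    using geometric_partial_sums_dyadic[OF assms(3)] by blast
  have "ennreal (C / \<epsilon>) \<le> ennreal (C * L)"
    using mult_left_mono[OF L(1) C] by (intro ennreal_leI) simp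
  also have "\<dots> \<le> sparse_form dyadic_chain p0 q0 (truncated_power b) (truncated_power d)"
    using part L(2)
    by (intro LIMSEQ_le_const2[OF tendsto_ennrealI[OF tendsto_mult_left]]) auto
  finally show ?thesis by (simp add: C_def \<rho>_def)
qed

lemma dual_weight_power:
  assumes "1 < p"
  shows "dual_weight p (\<lambda>x. \<bar>x\<bar> powr a) = (\<lambda>x. \<bar>x\<bar> powr - (a / (p - 1)))"
  using assms by (simp add: dual_weight_def powr_powr one_minus_conj_exponent)

section \<open>Sharpness of the exponent\<close>

text \<open>If the weight constants are of order \<open>\<epsilon>\<^sup>-\<^sup>\<kappa>\<close> and the sparse form gains the factor \<open>\<epsilon>\<^sup>-\<^sup>\<kappa>\<^sup>\<alpha>\<close>, where
  \<open>\<alpha>\<close> is the exponent in question, then only the factor \<open>1 / \<epsilon>\<close> of the sparse form and the two norms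
  \<open>\<epsilon>\<^bsup>-1/p\<^esup>\<close> and \<open>\<epsilon>\<^bsup>-1/p'\<^esup>\<close> are left, and these match exactly.\<close>

lemma power_weights_sharp:
  fixes p0 p \<kappa> l u :: real and q0 :: ereal and a b d :: "real \<Rightarrow> real"
  assumes "1 < p" "0 < \<kappa>" "0 < l" "0 < u" "0 \<le> sharp_exponent p0 q0 p"
    and member: "\<And>\<epsilon>. 0 < \<epsilon> \<Longrightarrow> \<epsilon> < 1 \<Longrightarrow> (\<lambda>x. \<bar>x\<bar> powr a \<epsilon>) \<in>
      A_class (p / p0) \<inter> RH_class (conj_exponent (q0 / ereal p))"
    and lower: "\<And>\<epsilon>. 0 < \<epsilon> \<Longrightarrow> \<epsilon> < 1 \<Longrightarrow>
      ennreal (l * \<epsilon> powr - \<kappa>) \<le> weight_const p0 q0 p (\<lambda>x. \<bar>x\<bar> powr a \<epsilon>)"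
    and upper: "\<And>\<epsilon>. 0 < \<epsilon> \<Longrightarrow> \<epsilon> < 1 \<Longrightarrow>
      weight_const p0 q0 p (\<lambda>x. \<bar>x\<bar> powr a \<epsilon>) \<le> ennreal (u * \<epsilon> powr - \<kappa>)"
    and a: "\<And>\<epsilon>. 0 < \<epsilon> \<Longrightarrow> \<epsilon> < 1 \<Longrightarrow> a \<epsilon> = b \<epsilon> * p - (1 - \<epsilon>)"
    and bd: "\<And>\<epsilon>. 0 < \<epsilon> \<Longrightarrow> \<epsilon> < 1 \<Longrightarrow> b \<epsilon> + d \<epsilon> = 1 - \<epsilon>"
    and sparse: "\<And>\<epsilon>. 0 < \<epsilon> \<Longrightarrow> \<epsilon> < 1 \<Longrightarrow>
      ennreal (\<epsilon> powr - (\<kappa> * sharp_exponent p0 q0 p) / \<epsilon>) \<le>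
        sparse_form dyadic_chain p0 q0 (truncated_power (b \<epsilon>)) (truncated_power (d \<epsilon>))"
  shows "\<exists>c>0. \<exists>\<epsilon>0>0. \<exists>\<omega> f g :: real \<Rightarrow> real \<Rightarrow> real.
    (\<forall>\<epsilon>. 0 < \<epsilon> \<and> \<epsilon> < \<epsilon>0 \<longrightarrow>
      \<omega> \<epsilon> \<in> A_class (p / p0) \<inter> RH_class (conj_exponent (q0 / ereal p)) \<and>
      f \<epsilon> \<in> wLp p (\<omega> \<epsilon>) \<and> \<not> (AE x in lebesgue. f \<epsilon> x = 0) \<and>
      g \<epsilon> \<in> wLp (conj_exponent p) (dual_weight p (\<omega> \<epsilon>)) \<and>
      \<not> (AE x in lebesgue. g \<epsilon> x = 0) \<and>
      sparse_form dyadic_chain p0 q0 (f \<epsilon>) (g \<epsilon>) \<ge>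
        ennreal c * weight_const p0 q0 p (\<omega> \<epsilon>) epowr sharp_exponent p0 q0 p
          * wnorm p (\<omega> \<epsilon>) (f \<epsilon>)
          * wnorm (conj_exponent p) (dual_weight p (\<omega> \<epsilon>)) (g \<epsilon>)) \<and>
    ((\<lambda>\<epsilon>. weight_const p0 q0 p (\<omega> \<epsilon>)) \<longlongrightarrow> \<infinity>) (at_right (0::real))"
proof -
  define \<alpha> where "\<alpha> = sharp_exponent p0 q0 p"
  define c where "c = u powr - \<alpha>"
  define \<omega> where "\<omega> = (\<lambda>\<epsilon> x. \<bar>x\<bar> powr a \<epsilon> :: real)"
  define f where "f = (\<lambda>\<epsilon>. truncated_power (b \<epsilon>))"
  define g where "g = (\<lambda>\<epsilon>. truncated_power (d \<epsilon>))"
  have c: "0 < c" using assms by (simp add: c_def)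
  have p': "conj_exponent (ereal p) = p / (p - 1)" "0 < p / (p - 1)"
    using assms by (auto simp: conj_exponent_real)
  have normf: "wnorm p (\<omega> \<epsilon>) (f \<epsilon>) = ennreal (\<epsilon> powr - (1 / p))"
    if "0 < \<epsilon>" "\<epsilon> < 1" for \<epsilon>
    unfolding \<omega>_def f_def using that assms(1) a[OF that] by (intro wnorm_truncated_power) auto
  have normg: "wnorm (conj_exponent (ereal p)) (dual_weight p (\<omega> \<epsilon>)) (g \<epsilon>) =
      ennreal (\<epsilon> powr - (1 - 1 / p))"
    if "0 < \<epsilon>" "\<epsilon> < 1" for \<epsilon>
  proof -
    have d: "d \<epsilon> = 1 - \<epsilon> - b \<epsilon>" using bd[OF that] by simp
    \<comment> \<open>The duality between \<open>\<omega>\<close> and \<open>\<sigma>\<close> turns the condition on \<open>a\<close> and \<open>b\<close> into the same one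
      for \<open>\<sigma>\<close> and \<open>d\<close>.\<close>
    have "- (a \<epsilon> / (p - 1)) - d \<epsilon> * (p / (p - 1)) = - ((a \<epsilon> + d \<epsilon> * p) / (p - 1))"
      by (simp add: add_divide_distrib)
    also have "a \<epsilon> + d \<epsilon> * p = (1 - \<epsilon>) * (p - 1)"
      unfolding a[OF that] d by (simp add: algebra_simps)
    finally have "- (a \<epsilon> / (p - 1)) - d \<epsilon> * (p / (p - 1)) = \<epsilon> - 1"
      using assms(1) by simp
    then have "wnorm (p / (p - 1)) (\<lambda>x. \<bar>x\<bar> powr - (a \<epsilon> / (p - 1))) (truncated_power (d \<epsilon>)) =
        ennreal (\<epsilon> powr - (1 / (p / (p - 1))))"
      using that p' by (intro wnorm_truncated_power) auto
    also have "1 / (p / (p - 1)) = 1 - 1 / p"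
      using assms(1) by (simp add: field_simps)
    finally show ?thesis
      by (simp add: p' \<omega>_def g_def dual_weight_power[OF assms(1)])
  qed
  have bound: "ennreal c * weight_const p0 q0 p (\<omega> \<epsilon>) epowr \<alpha> * wnorm p (\<omega> \<epsilon>) (f \<epsilon>)
        * wnorm (conj_exponent (ereal p)) (dual_weight p (\<omega> \<epsilon>)) (g \<epsilon>)
      \<le> sparse_form dyadic_chain p0 q0 (f \<epsilon>) (g \<epsilon>)" if \<epsilon>: "0 < \<epsilon>" "\<epsilon> < 1" for \<epsilon>
  proof -
    have "ennreal c * weight_const p0 q0 p (\<omega> \<epsilon>) epowr \<alpha> * wnorm p (\<omega> \<epsilon>) (f \<epsilon>)
        * wnorm (conj_exponent (ereal p)) (dual_weight p (\<omega> \<epsilon>)) (g \<epsilon>)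
      \<le> ennreal c * ennreal (u * \<epsilon> powr - \<kappa>) epowr \<alpha> * ennreal (\<epsilon> powr - (1 / p))
        * ennreal (\<epsilon> powr - (1 - 1 / p))"
      unfolding normf[OF \<epsilon>] normg[OF \<epsilon>] using assms(5) upper[OF \<epsilon>]
      by (intro mult_mono epowr_mono) (auto simp: \<alpha>_def \<omega>_def)
    also have "\<dots> = ennreal (c * (u powr \<alpha> * \<epsilon> powr (- \<kappa> * \<alpha>)) *
        (\<epsilon> powr - (1 / p) * \<epsilon> powr - (1 - 1 / p)))"
      using assms(4) c by (simp add: epowr_ennreal powr_mult powr_powr mult.assoc flip: ennreal_mult)
    also have "\<epsilon> powr - (1 / p) * \<epsilon> powr - (1 - 1 / p) = \<epsilon> powr - 1"
      by (simp flip: powr_add)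
    also have "\<epsilon> powr - 1 = 1 / \<epsilon>"
      using \<epsilon> by (simp add: powr_minus_divide)
    also have "c * (u powr \<alpha> * \<epsilon> powr (- \<kappa> * \<alpha>)) * (1 / \<epsilon>) = \<epsilon> powr - (\<kappa> * \<alpha>) / \<epsilon>"
      using assms(4) by (simp add: c_def powr_minus)
    also have "ennreal \<dots> \<le> sparse_form dyadic_chain p0 q0 (f \<epsilon>) (g \<epsilon>)"
      using sparse[OF \<epsilon>] by (simp add: \<alpha>_def f_def g_def)
    finally show ?thesis .
  qed
  have "((\<lambda>\<epsilon>. weight_const p0 q0 p (\<omega> \<epsilon>)) \<longlongrightarrow> top) (at_right 0)"
  proof (rule tendsto_sandwich)
    show "\<forall>\<^sub>F \<epsilon> in at_right 0. ennreal (l * \<epsilon> powr - \<kappa>) \<le> weight_const p0 q0 p (\<omega> \<epsilon>)"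
      using eventually_at_right_real[of 0 1]
      by (auto elim!: eventually_mono simp: \<omega>_def intro!: lower)
    have "filterlim (\<lambda>\<epsilon>. l * \<epsilon> powr - \<kappa>) at_top (at_right 0)"
      using assms by real_asymp
    then show "((\<lambda>\<epsilon>. ennreal (l * \<epsilon> powr - \<kappa>)) \<longlongrightarrow> top) (at_right 0)"
      by (simp add: ennreal_tendsto_top_eq_at_top)
  qed (auto intro: tendsto_const)
  moreover have "\<forall>\<epsilon>. 0 < \<epsilon> \<and> \<epsilon> < 1 \<longrightarrow>
      \<omega> \<epsilon> \<in> A_class (p / p0) \<inter> RH_class (conj_exponent (q0 / ereal p)) \<and>
      f \<epsilon> \<in> wLp p (\<omega> \<epsilon>) \<and> \<not> (AE x in lebesgue. f \<epsilon> x = 0) \<and>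
      g \<epsilon> \<in> wLp (conj_exponent p) (dual_weight p (\<omega> \<epsilon>)) \<and>
      \<not> (AE x in lebesgue. g \<epsilon> x = 0) \<and>
      ennreal c * weight_const p0 q0 p (\<omega> \<epsilon>) epowr sharp_exponent p0 q0 p
          * wnorm p (\<omega> \<epsilon>) (f \<epsilon>)
          * wnorm (conj_exponent p) (dual_weight p (\<omega> \<epsilon>)) (g \<epsilon>)
        \<le> sparse_form dyadic_chain p0 q0 (f \<epsilon>) (g \<epsilon>)"
  proof (intro allI impI conjI)
    fix \<epsilon> :: real assume "0 < \<epsilon> \<and> \<epsilon> < 1"
    then have \<epsilon>: "0 < \<epsilon>" "\<epsilon> < 1" by auto
    show "\<omega> \<epsilon> \<in> A_class (p / p0) \<inter> RH_class (conj_exponent (q0 / ereal p))"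
      using member[OF \<epsilon>] by (simp add: \<omega>_def)
    show "f \<epsilon> \<in> wLp p (\<omega> \<epsilon>)"
      using normf[OF \<epsilon>] truncated_power_measurable by (simp add: wLp_def f_def)
    show "g \<epsilon> \<in> wLp (conj_exponent p) (dual_weight p (\<omega> \<epsilon>))"
      using normg[OF \<epsilon>] truncated_power_measurable by (simp add: wLp_def g_def)
    show "\<not> (AE x in lebesgue. f \<epsilon> x = 0)" "\<not> (AE x in lebesgue. g \<epsilon> x = 0)"
      unfolding f_def g_def by (rule truncated_power_not_AE_zero)+
    show "ennreal c * weight_const p0 q0 p (\<omega> \<epsilon>) epowr sharp_exponent p0 q0 p
          * wnorm p (\<omega> \<epsilon>) (f \<epsilon>)
          * wnorm (conj_exponent p) (dual_weight p (\<omega> \<epsilon>)) (g \<epsilon>)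
        \<le> sparse_form dyadic_chain p0 q0 (f \<epsilon>) (g \<epsilon>)"
      using bound[OF \<epsilon>] by (simp add: \<alpha>_def)
  qed
  ultimately show ?thesis
    using c by (intro exI[of _ c] conjI exI[of _ "1::real"] exI[of _ \<omega>] exI[of _ f] exI[of _ g]) auto
qed

theorem proposition7p1:
  fixes p0 p :: real and q0 :: ereal
  assumes "1 \<le> p0" and "p0 < 2" and "2 < q0"
    and "p0 < p" and "ereal p < q0"
  shows "\<exists>c>0. \<exists>\<epsilon>0>0. \<exists>\<omega> f g :: real \<Rightarrow> real \<Rightarrow> real.
    (\<forall>\<epsilon>. 0 < \<epsilon> \<and> \<epsilon> < \<epsilon>0 \<longrightarrow>
      \<omega> \<epsilon> \<in> A_class (p / p0) \<inter> RH_class (conj_exponent (q0 / ereal p)) \<and>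
      f \<epsilon> \<in> wLp p (\<omega> \<epsilon>) \<and> \<not> (AE x in lebesgue. f \<epsilon> x = 0) \<and>
      g \<epsilon> \<in> wLp (conj_exponent p) (dual_weight p (\<omega> \<epsilon>)) \<and>
      \<not> (AE x in lebesgue. g \<epsilon> x = 0) \<and>
      sparse_form dyadic_chain p0 q0 (f \<epsilon>) (g \<epsilon>) \<ge>
        ennreal c * weight_const p0 q0 p (\<omega> \<epsilon>) epowr sharp_exponent p0 q0 p
          * wnorm p (\<omega> \<epsilon>) (f \<epsilon>)
          * wnorm (conj_exponent p) (dual_weight p (\<omega> \<epsilon>)) (g \<epsilon>)) \<and>
    ((\<lambda>\<epsilon>. weight_const p0 q0 p (\<omega> \<epsilon>)) \<longlongrightarrow> \<infinity>) (at_right (0::real))"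
proof -
  define q where "q = p / p0"
  define s where "s = conj_exponent (q0 / ereal p)"
  define \<rho> where "\<rho> = conj_exponent q0"
  have p: "1 < p" "0 < p0" and q: "1 < q"
    using assms by (auto simp: q_def)
  have \<rho>: "1 \<le> \<rho>" and s: "1 \<le> s" and s\<rho>: "1 / s = 1 - p + p / \<rho>"
    and \<alpha>: "\<not> p \<le> critical_exponent p0 q0 \<Longrightarrow> 1 / s * sharp_exponent p0 q0 p = 1 / \<rho>"
    using exponent_relations[of q0 p] assms p by (auto simp: s_def \<rho>_def)
  show ?thesis
  proof (cases "p \<le> critical_exponent p0 q0")
    case True
    define a b d where "a \<epsilon> = (q - 1) * (1 - \<epsilon>)" and "b \<epsilon> = (1 - \<epsilon>) / p0"
      and "d \<epsilon> = (1 - \<epsilon>) * (1 - 1 / p0)" for \<epsilon> :: real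
    have \<alpha>: "sharp_exponent p0 q0 p = 1 / (p - p0)"
      using True by (simp add: sharp_exponent_def)
    \<comment> \<open>The rate of the weight constants times the sharp exponent is the gain exponent of \<open>f\<close>.\<close>
    have \<kappa>\<alpha>: "(q - 1) * (1 / (p - p0)) = 1 / p0"
      using assms p by (simp add: q_def field_simps)
    note bounds = A_extremal_power_bounds[OF q s, folded a_def]
    define l u where "l = 1 / q * (1 / (1 + (q - 1) * s))" and "u = 2 * 2 powr (q - 1) * (4 * q)"
    have lu: "0 < l" "0 < u"
      using q s by (auto simp: l_def u_def intro!: mult_pos_pos add_pos_nonneg)
    show ?thesis
    proof (rule power_weights_sharp[of p "q - 1" l u p0 q0 a b d, OF p(1) _ lu])
      fix \<epsilon> :: real assume \<epsilon>: "0 < \<epsilon>" "\<epsilon> < 1"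
      have "A_const q (\<lambda>x. \<bar>x\<bar> powr a \<epsilon>) < \<infinity>" "RH_const s (\<lambda>x. \<bar>x\<bar> powr a \<epsilon>) < \<infinity>"
        using bounds(2,4)[OF \<epsilon>] by (auto elim!: le_less_trans)
      then show "(\<lambda>x. \<bar>x\<bar> powr a \<epsilon>) \<in> A_class (p / p0) \<inter> RH_class (conj_exponent (q0 / ereal p))"
        by (simp add: A_class_def RH_class_def weight_power q_def s_def)
      have "ennreal (l * \<epsilon> powr - (q - 1)) =
          ennreal (1 / q * \<epsilon> powr - (q - 1)) * ennreal (1 / (1 + (q - 1) * s))"
        using q s by (simp add: l_def mult_ac flip: ennreal_mult)
      also have "\<dots> \<le> weight_const p0 q0 p (\<lambda>x. \<bar>x\<bar> powr a \<epsilon>)"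
        unfolding weight_const_def s_def[symmetric] q_def[symmetric]
        using bounds[OF \<epsilon>] by (intro mult_mono) auto
      finally show "ennreal (l * \<epsilon> powr - (q - 1)) \<le> weight_const p0 q0 p (\<lambda>x. \<bar>x\<bar> powr a \<epsilon>)" .
      have "weight_const p0 q0 p (\<lambda>x. \<bar>x\<bar> powr a \<epsilon>) \<le>
          ennreal (2 * 2 powr (q - 1) * \<epsilon> powr - (q - 1)) * ennreal (4 * q)"
        unfolding weight_const_def s_def[symmetric] q_def[symmetric]
        using bounds[OF \<epsilon>] by (intro mult_mono) auto
      also have "\<dots> = ennreal (u * \<epsilon> powr - (q - 1))"
        using q by (simp add: u_def mult_ac flip: ennreal_mult)
      finally show "weight_const p0 q0 p (\<lambda>x. \<bar>x\<bar> powr a \<epsilon>) \<le> ennreal (u * \<epsilon> powr - (q - 1))" .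
      show "a \<epsilon> = b \<epsilon> * p - (1 - \<epsilon>)" and bd: "b \<epsilon> + d \<epsilon> = 1 - \<epsilon>"
        by (simp_all add: a_def b_def d_def q_def algebra_simps)
      have "ennreal ((1 / \<epsilon>) powr (1 / p0) * 1 powr (1 / conj_exponent q0) / \<epsilon>) \<le>
          sparse_form dyadic_chain p0 q0 (truncated_power (b \<epsilon>)) (truncated_power (d \<epsilon>))"
      proof (rule sparse_form_truncated_power_ge[OF _ _ _ bd])
        fix h :: real assume h: "0 < h"
        show "ennreal (1 / \<epsilon> * h powr - (b \<epsilon> * p0)) \<le> average {0..h} (\<lambda>x. \<bar>x\<bar> powr - (b \<epsilon> * p0))"
          using average_power_from_0[of "\<epsilon> - 1" h] h \<epsilon> p by (simp add: b_def)
        \<comment> \<open>The whole gain comes from \<open>f\<close>; for \<open>g\<close> the monotonicity of the power is enough.\<close>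
        have "0 \<le> d \<epsilon> * conj_exponent q0"
          using \<rho> \<epsilon> assms unfolding d_def \<rho>_def[symmetric] by (intro mult_nonneg_nonneg) auto
        then show "ennreal (1 * h powr - (d \<epsilon> * conj_exponent q0)) \<le>
            average {0..h} (\<lambda>x. \<bar>x\<bar> powr - (d \<epsilon> * conj_exponent q0))"
          using average_power_from_0_ge h by simp
      qed (use p \<epsilon> \<rho> in \<open>auto simp: \<rho>_def\<close>)
      then show "ennreal (\<epsilon> powr - ((q - 1) * sharp_exponent p0 q0 p) / \<epsilon>) \<le>
          sparse_form dyadic_chain p0 q0 (truncated_power (b \<epsilon>)) (truncated_power (d \<epsilon>))"
        unfolding \<alpha> \<kappa>\<alpha> using \<epsilon> by (simp add: powr_divide powr_minus_divide)
    qed (use q assms \<alpha> in auto)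
  next
    case False
    define a b d where "a \<epsilon> = - (1 / s * (1 - \<epsilon>))" and "b \<epsilon> = (1 - \<epsilon>) * (1 - 1 / \<rho>)"
      and "d \<epsilon> = (1 - \<epsilon>) / \<rho>" for \<epsilon> :: real
    note \<alpha> = \<alpha>[OF False]
    have "0 < 1 / s * sharp_exponent p0 q0 p" using \<alpha> \<rho> by simp
    then have \<alpha>pos: "0 \<le> sharp_exponent p0 q0 p"
      using s by (simp add: zero_less_divide_iff)
    obtain l u where lu: "0 < l" "0 < u"
      and bounds: "\<And>\<epsilon>. 0 < \<epsilon> \<Longrightarrow> \<epsilon> < 1 \<Longrightarrow> A_const q (\<lambda>x. \<bar>x\<bar> powr a \<epsilon>) < \<infinity>"
        "\<And>\<epsilon>. 0 < \<epsilon> \<Longrightarrow> \<epsilon> < 1 \<Longrightarrow> RH_const s (\<lambda>x. \<bar>x\<bar> powr a \<epsilon>) < \<infinity>"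
        "\<And>\<epsilon>. 0 < \<epsilon> \<Longrightarrow> \<epsilon> < 1 \<Longrightarrow> ennreal (l * \<epsilon> powr - (1 / s)) \<le>
          A_const q (\<lambda>x. \<bar>x\<bar> powr a \<epsilon>) * RH_const s (\<lambda>x. \<bar>x\<bar> powr a \<epsilon>)"
        "\<And>\<epsilon>. 0 < \<epsilon> \<Longrightarrow> \<epsilon> < 1 \<Longrightarrow>
          A_const q (\<lambda>x. \<bar>x\<bar> powr a \<epsilon>) * RH_const s (\<lambda>x. \<bar>x\<bar> powr a \<epsilon>)
            \<le> ennreal (u * \<epsilon> powr - (1 / s))"
      unfolding a_def using RH_extremal_power_bounds[OF q s] by blast
    show ?thesis
    proof (rule power_weights_sharp[of p "1 / s" l u p0 q0 a b d, OF p(1) _ lu \<alpha>pos])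
      fix \<epsilon> :: real assume \<epsilon>: "0 < \<epsilon>" "\<epsilon> < 1"
      show "(\<lambda>x. \<bar>x\<bar> powr a \<epsilon>) \<in> A_class (p / p0) \<inter> RH_class (conj_exponent (q0 / ereal p))"
        using bounds(1,2)[OF \<epsilon>] by (simp add: A_class_def RH_class_def weight_power q_def s_def)
      show "ennreal (l * \<epsilon> powr - (1 / s)) \<le> weight_const p0 q0 p (\<lambda>x. \<bar>x\<bar> powr a \<epsilon>)"
        "weight_const p0 q0 p (\<lambda>x. \<bar>x\<bar> powr a \<epsilon>) \<le> ennreal (u * \<epsilon> powr - (1 / s))"
        using bounds(3,4)[OF \<epsilon>] by (auto simp: weight_const_def s_def q_def)
      show "a \<epsilon> = b \<epsilon> * p - (1 - \<epsilon>)"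
        unfolding a_def b_def s\<rho> by (simp add: algebra_simps)
      show bd: "b \<epsilon> + d \<epsilon> = 1 - \<epsilon>"
        by (simp add: b_def d_def algebra_simps)
      have "ennreal (1 powr (1 / p0) * (1 / \<epsilon>) powr (1 / conj_exponent q0) / \<epsilon>) \<le>
          sparse_form dyadic_chain p0 q0 (truncated_power (b \<epsilon>)) (truncated_power (d \<epsilon>))"
      proof (rule sparse_form_truncated_power_ge[OF _ _ _ bd])
        fix h :: real assume h: "0 < h"
        have "0 \<le> b \<epsilon> * p0"
          using \<rho> \<epsilon> assms unfolding b_def by (intro mult_nonneg_nonneg) auto
        then show "ennreal (1 * h powr - (b \<epsilon> * p0)) \<le> average {0..h} (\<lambda>x. \<bar>x\<bar> powr - (b \<epsilon> * p0))"
          using average_power_from_0_ge h by simp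
        show "ennreal (1 / \<epsilon> * h powr - (d \<epsilon> * conj_exponent q0)) \<le>
            average {0..h} (\<lambda>x. \<bar>x\<bar> powr - (d \<epsilon> * conj_exponent q0))"
          unfolding \<rho>_def[symmetric]
          using average_power_from_0[of "\<epsilon> - 1" h] h \<epsilon> \<rho> by (simp add: d_def)
      qed (use p \<epsilon> \<rho> in \<open>auto simp: \<rho>_def\<close>)
      then show "ennreal (\<epsilon> powr - (1 / s * sharp_exponent p0 q0 p) / \<epsilon>) \<le>
          sparse_form dyadic_chain p0 q0 (truncated_power (b \<epsilon>)) (truncated_power (d \<epsilon>))"
        unfolding \<alpha> using \<epsilon> by (simp add: \<rho>_def powr_divide powr_minus_divide)
    qed (use s in auto)
  qed
qed

end
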